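(* Let $R$ be a commutative noetherian local ring of positive dimension such that $\operatorname{Ass}(R)=\operatorname{Assh}(R)$, and let $M$ be a finitely generated $R$-module with $\lambda(M)<\infty$ and $\operatorname{p.dim}_R(M)=\infty$. Then $\operatorname{Supp}(\operatorname{Syz}_i(M))=\operatorname{Spec}(R)$ for all $i>0$.
   Context: $\operatorname{Assh}(R)$ is the set of all prime ideals $\mathfrak p$ of $R$ with $\dim(R)=\dim(R/\mathfrak p)$. $\operatorname{p.dim}$ denotes projective dimension and $\lambda(-)$ denotes length. For a finitely generated module $M$ over a local ring $R$, let $\cdots\to R^{\beta_{i+1}}\xrightarrow{f_{i+1}}R^{\beta_i}\xrightarrow{f_i}\cdots\to R^{\beta_0}\xrightarrow{f_0}M\to 0$ be the minimal free resolution. For $i>0$, $\operatorname{Syz}_i(M):=\operatorname{coker}(f_{i+1})=\ker(f_{i-1})$ is the $i$-th syzygy module. *)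

theory Defs
  imports "HOL-Algebra.Module" "HOL-Algebra.Ring_Divisibility" "HOL-Library.Extended_Nat"
begin

section \<open>Spectrum, dimension and length\<close>

definition local_ring :: "('a, 'c) ring_scheme \<Rightarrow> bool" where
  "local_ring R \<longleftrightarrow> cring R \<and> (\<exists>!m. maximalideal m R)"

definition Spec :: "('a, 'c) ring_scheme \<Rightarrow> 'a set set" where
  "Spec R = {p. primeideal p R}"

text \<open>Supremum of the lengths \<open>n\<close> of strict chains \<open>c 0 \<subset> \<dots> \<subset> c n\<close> of members of \<open>S\<close>.\<close>

definition chain_height :: "'x set set \<Rightarrow> enat" where
  "chain_height S =
     Sup {enat n | n. \<exists>c. (\<forall>i\<le>n. c i \<in> S) \<and> (\<forall>i<n. c i \<subset> c (Suc i))}"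

definition krull_dim :: "('a, 'c) ring_scheme \<Rightarrow> enat" where
  "krull_dim R = chain_height (Spec R)"

definition module_length :: "('a, 'c) ring_scheme \<Rightarrow> ('a, 'b, 'd) module_scheme \<Rightarrow> enat" where
  "module_length R M = chain_height {N. submodule N R M}"

definition finitely_generated :: "('a, 'c) ring_scheme \<Rightarrow> ('a, 'b, 'd) module_scheme \<Rightarrow> bool" where
  "finitely_generated R M \<longleftrightarrow>
     (\<exists>A \<subseteq> carrier M. finite A \<and> (\<forall>N. submodule N R M \<and> A \<subseteq> N \<longrightarrow> N = carrier M))"


section \<open>Associated primes\<close>

definition annihilator :: "('a, 'c) ring_scheme \<Rightarrow> ('a, 'b, 'd) module_scheme \<Rightarrow> 'b \<Rightarrow> 'a set" where
  "annihilator R M x = {a \<in> carrier R. a \<odot>\<^bsub>M\<^esub> x = \<zero>\<^bsub>M\<^esub>}"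

definition Ass :: "('a, 'c) ring_scheme \<Rightarrow> ('a, 'b, 'd) module_scheme \<Rightarrow> 'a set set" where
  "Ass R M = {p \<in> Spec R. \<exists>x \<in> carrier M. p = annihilator R M x}"

text \<open>The ring \<open>R\<close> as a module over itself.\<close>

definition regular_module :: "('a, 'c) ring_scheme \<Rightarrow> ('a, 'a) module" where
  "regular_module R =
     \<lparr>carrier = carrier R, monoid.mult = monoid.mult R, one = one R,
      ring.zero = ring.zero R, add = add R, smult = monoid.mult R\<rparr>"

definition Assh :: "('a, 'c) ring_scheme \<Rightarrow> 'a set set" where
  "Assh R = {p \<in> Spec R. krull_dim R = krull_dim (R Quot p)}"


section \<open>Localization and support\<close>

text \<open>In the \<open>module\<close> record the fields \<open>mult\<close> and \<open>one\<close> play no role for modules;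
  here and below they are left undefined.\<close>

definition fraction_rel ::
  "('a, 'c) ring_scheme \<Rightarrow> 'a set \<Rightarrow> ('a, 'b, 'd) module_scheme \<Rightarrow> (('b \<times> 'a) \<times> ('b \<times> 'a)) set" where
  "fraction_rel R S M =
     {((x, s), (y, t)). x \<in> carrier M \<and> y \<in> carrier M \<and> s \<in> S \<and> t \<in> S \<and>
        (\<exists>u\<in>S. u \<odot>\<^bsub>M\<^esub> (t \<odot>\<^bsub>M\<^esub> x) = u \<odot>\<^bsub>M\<^esub> (s \<odot>\<^bsub>M\<^esub> y))}"

text \<open>The localization of \<open>M\<close> at the multiplicative set \<open>S\<close>, regarded as an \<open>R\<close>-module; the pair
  \<open>(x, s)\<close> represents the fraction \<open>x / s\<close>.\<close>

definition localized_module ::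
  "('a, 'c) ring_scheme \<Rightarrow> 'a set \<Rightarrow> ('a, 'b, 'd) module_scheme \<Rightarrow> ('a, ('b \<times> 'a) set) module" where
  "localized_module R S M =
     \<lparr>carrier = (carrier M \<times> S) // fraction_rel R S M,
      monoid.mult = undefined, one = undefined,
      ring.zero = fraction_rel R S M `` {(\<zero>\<^bsub>M\<^esub>, \<one>\<^bsub>R\<^esub>)},
      add = (\<lambda>X Y. \<Union>(x, s)\<in>X. \<Union>(y, t)\<in>Y.
               fraction_rel R S M `` {((t \<odot>\<^bsub>M\<^esub> x) \<oplus>\<^bsub>M\<^esub> (s \<odot>\<^bsub>M\<^esub> y), s \<otimes>\<^bsub>R\<^esub> t)}),
      smult = (\<lambda>a X. \<Union>(x, s)\<in>X. fraction_rel R S M `` {(a \<odot>\<^bsub>M\<^esub> x, s)})\<rparr>"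

definition Supp :: "('a, 'c) ring_scheme \<Rightarrow> ('a, 'b, 'd) module_scheme \<Rightarrow> 'a set set" where
  "Supp R M = {p \<in> Spec R. let Mp = localized_module R (carrier R - p) M
                            in carrier Mp \<noteq> {\<zero>\<^bsub>Mp\<^esub>}}"


section \<open>Resolutions\<close>

definition module_hom ::
  "('a, 'c) ring_scheme \<Rightarrow> ('a, 'b, 'd) module_scheme \<Rightarrow> ('a, 'e, 'f) module_scheme \<Rightarrow> ('b \<Rightarrow> 'e) set" where
  "module_hom R M N =
     {h \<in> carrier M \<rightarrow> carrier N.
        (\<forall>x\<in>carrier M. \<forall>y\<in>carrier M. h (x \<oplus>\<^bsub>M\<^esub> y) = h x \<oplus>\<^bsub>N\<^esub> h y) \<and>
        (\<forall>a\<in>carrier R. \<forall>x\<in>carrier M. h (a \<odot>\<^bsub>M\<^esub> x) = a \<odot>\<^bsub>N\<^esub> h x)}"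

definition module_ker ::
  "('a, 'b, 'd) module_scheme \<Rightarrow> ('a, 'e, 'f) module_scheme \<Rightarrow> ('b \<Rightarrow> 'e) \<Rightarrow> 'b set" where
  "module_ker M N h = {x \<in> carrier M. h x = \<zero>\<^bsub>N\<^esub>}"

text \<open>\<open>\<dots> \<rightarrow> P 2 \<rightarrow> P 1 \<rightarrow> P 0 \<rightarrow> M \<rightarrow> 0\<close> is exact, with augmentation \<open>e : P 0 \<rightarrow> M\<close> and differentials
  \<open>f i : P i \<rightarrow> P (i - 1)\<close> for \<open>i \<ge> 1\<close>. The augmentation has a different type from the other maps
  and is therefore kept apart; the value \<open>f 0\<close> is never used.\<close>

definition resolution ::
  "('a, 'c) ring_scheme \<Rightarrow> ('a, 'b, 'd) module_scheme \<Rightarrow> (nat \<Rightarrow> ('a, 'p) module) \<Rightarrow>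
     ('p \<Rightarrow> 'b) \<Rightarrow> (nat \<Rightarrow> 'p \<Rightarrow> 'p) \<Rightarrow> bool" where
  "resolution R M P e f \<longleftrightarrow>
     (\<forall>i. module R (P i)) \<and>
     e \<in> module_hom R (P 0) M \<and>
     (\<forall>i. f (Suc i) \<in> module_hom R (P (Suc i)) (P i)) \<and>
     e ` carrier (P 0) = carrier M \<and>
     f 1 ` carrier (P 1) = module_ker (P 0) M e \<and>
     (\<forall>i. f (Suc (Suc i)) ` carrier (P (Suc (Suc i))) = module_ker (P (Suc i)) (P i) (f (Suc i)))"

text \<open>Projectivity is the lifting property along surjections. The test modules \<open>N\<close>, \<open>N'\<close> have their
  elements in the type \<open>'p \<Rightarrow> 'a\<close>. For a nonzero ring this is no restriction: that type is large enough
  for the free module with basis \<open>carrier P\<close> and, through indicator functions, for a copy of \<open>P\<close>, so the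
  condition forces \<open>P\<close> to be a direct summand of a free module.\<close>

definition projective_module :: "('a, 'c) ring_scheme \<Rightarrow> ('a, 'p) module \<Rightarrow> bool" where
  "projective_module R P \<longleftrightarrow>
     module R P \<and>
     (\<forall>(N :: ('a, 'p \<Rightarrow> 'a) module) (N' :: ('a, 'p \<Rightarrow> 'a) module) g h.
        module R N \<and> module R N' \<and>
        g \<in> module_hom R N N' \<and> g ` carrier N = carrier N' \<and> h \<in> module_hom R P N' \<longrightarrow>
        (\<exists>k \<in> module_hom R P N. \<forall>x\<in>carrier P. g (k x) = h x))"

text \<open>The infimum of the lengths of projective resolutions, \<open>\<infinity>\<close> if there is no finite one. The
  resolving modules have their elements in the type \<open>nat \<Rightarrow> 'a\<close>, which carries all finitely generated
  free modules and their submodules. For a finitely generated module over a noetherian ring this gives the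
  usual projective dimension: by dimension shifting, \<open>pd M \<le> n\<close> is witnessed by finitely generated free
  modules in degrees below \<open>n\<close> and the projective \<open>n\<close>-th syzygy. The zero module gets the value \<open>0\<close>.\<close>

definition proj_dim :: "('a, 'c) ring_scheme \<Rightarrow> ('a, 'b, 'd) module_scheme \<Rightarrow> enat" where
  "proj_dim R M =
     Inf {enat n | n. \<exists>(P :: nat \<Rightarrow> ('a, nat \<Rightarrow> 'a) module) e f.
            resolution R M P e f \<and> (\<forall>i. projective_module R (P i)) \<and>
            (\<forall>i>n. carrier (P i) = {\<zero>\<^bsub>P i\<^esub>})}"

text \<open>The free module \<open>R\<^sup>n\<close>, with vectors as extensional functions on \<open>{..<n}\<close>.\<close>

definition free_module :: "('a, 'c) ring_scheme \<Rightarrow> nat \<Rightarrow> ('a, nat \<Rightarrow> 'a) module" where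
  "free_module R n =
     \<lparr>carrier = {..<n} \<rightarrow>\<^sub>E carrier R,
      monoid.mult = undefined, one = undefined,
      ring.zero = (\<lambda>i\<in>{..<n}. \<zero>\<^bsub>R\<^esub>),
      add = (\<lambda>v w. \<lambda>i\<in>{..<n}. v i \<oplus>\<^bsub>R\<^esub> w i),
      smult = (\<lambda>a v. \<lambda>i\<in>{..<n}. a \<otimes>\<^bsub>R\<^esub> v i)\<rparr>"

text \<open>A free resolution is minimal if each differential \<open>f i\<close> with \<open>i \<ge> 1\<close> maps into \<open>m R\<^sup>b\<close>, where \<open>b\<close>
  is the rank in degree \<open>i - 1\<close>; this submodule consists of the vectors with all entries in \<open>m\<close>.\<close>

definition minimal_free_resolution ::
  "('a, 'c) ring_scheme \<Rightarrow> ('a, 'b, 'd) module_scheme \<Rightarrow> (nat \<Rightarrow> nat) \<Rightarrow>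
     ((nat \<Rightarrow> 'a) \<Rightarrow> 'b) \<Rightarrow> (nat \<Rightarrow> (nat \<Rightarrow> 'a) \<Rightarrow> (nat \<Rightarrow> 'a)) \<Rightarrow> bool" where
  "minimal_free_resolution R M \<beta> e f \<longleftrightarrow>
     resolution R M (\<lambda>i. free_module R (\<beta> i)) e f \<and>
     (\<forall>m. maximalideal m R \<longrightarrow>
        (\<forall>i. f (Suc i) ` carrier (free_module R (\<beta> (Suc i))) \<subseteq> ({..<\<beta> i} \<rightarrow>\<^sub>E m)))"

text \<open>The \<open>i\<close>-th syzygy module, for \<open>i > 0\<close>, of the resolution given by \<open>\<beta>\<close>, \<open>e\<close>, \<open>f\<close>: the kernel of the map
  leaving degree \<open>i - 1\<close>, which is \<open>e\<close> for \<open>i = 1\<close>.\<close>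

definition Syz ::
  "('a, 'c) ring_scheme \<Rightarrow> ('a, 'b, 'd) module_scheme \<Rightarrow> (nat \<Rightarrow> nat) \<Rightarrow>
     ((nat \<Rightarrow> 'a) \<Rightarrow> 'b) \<Rightarrow> (nat \<Rightarrow> (nat \<Rightarrow> 'a) \<Rightarrow> (nat \<Rightarrow> 'a)) \<Rightarrow> nat \<Rightarrow> ('a, nat \<Rightarrow> 'a) module" where
  "Syz R M \<beta> e f i =
     (let F = (\<lambda>j. free_module R (\<beta> j))
      in F (i - 1)\<lparr>carrier :=
           (if i = 1 then module_ker (F 0) M e
            else module_ker (F (i - 1)) (F (i - 2)) (f (i - 1)))\<rparr>)"

end

theory Submission
  imports Defs
begin

text \<open>
  Let \<open>Z\<close> be a syzygy module of \<open>M\<close>, and suppose that some prime \<open>p\<close> is missing from its support. The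
  classical argument localizes at the associated primes \<open>q\<close> of \<open>R\<close>. None of them is the maximal ideal
  \<open>m\<close>, because \<open>dim (R / q) = dim R > 0\<close>; hence \<open>M\<^sub>q = 0\<close>, the localized resolution splits, and \<open>Z\<^sub>q\<close> is
  stably free of a rank which is an alternating sum of Betti numbers and so does not depend on \<open>q\<close>.
  An associated prime inside \<open>p\<close> shows that this rank is \<open>0\<close>; then \<open>Z\<^sub>q = 0\<close> for all associated \<open>q\<close>, and
  \<open>Z = 0\<close> because \<open>Z\<close> lies in a free module. Now the resolution can be cut off, and \<open>M\<close> has
  finite projective dimension.

  Below, inverting elements is replaced by keeping track of scalars. Every \<open>y \<in> m\<close> has a power that kills \<open>M\<close>
  (\<open>finite_length_power_kills\<close>). Up to a power of \<open>y\<close> the resolution therefore splits, and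
  \<open>Z \<oplus> R\<^sup>b\<close> is isomorphic to \<open>R\<^sup>a\<close> up to a power of \<open>y\<close>, where \<open>a\<close> and \<open>b\<close> are the two sums of every other
  Betti number and do not depend on \<open>y\<close> (\<open>Syz_stably_free\<close>). Everything about ranks comes from
  one fact about a noetherian ring (\<open>almost_surjective_endo_kernel\<close>): an endomorphism of \<open>R\<^sup>n\<close> whose image
  contains \<open>s R\<^sup>n\<close> has a kernel in which each element is killed by a power of \<open>s\<close>. It has two
  consequences:

  \<^item> If \<open>t\<close> kills \<open>Z\<close> and \<open>t y\<close> is not nilpotent, then \<open>a \<le> b\<close> (\<open>stably_free_rank_le\<close>).
  \<^item> If \<open>a \<le> b\<close>, then every element of \<open>Z\<close> is killed by a power of \<open>y\<close> (\<open>stably_free_torsion\<close>).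

  As \<open>Z\<close> is finitely generated, \<open>p \<notin> Supp Z\<close> gives a \<open>t \<notin> p\<close> with \<open>t Z = 0\<close>. If \<open>t\<close> is a unit, then
  \<open>Z = 0\<close>. Otherwise \<open>t \<in> m\<close>, and the first consequence with \<open>y = t\<close> yields \<open>a \<le> b\<close>, as powers of \<open>t\<close> stay
  outside \<open>p\<close>. By the second consequence every element of \<open>Z\<close> is then killed by powers of all \<open>y \<in> m\<close>. A
  nonzero coordinate of such an element would make \<open>m\<close> an associated prime of \<open>R\<close>
  (\<open>torsion_maximalideal_in_Ass\<close>), but \<open>dim (R / m) = 0 < dim R\<close>. So \<open>Z = 0\<close> in this case, too.
\<close>

section \<open>Linear maps\<close>

lemma module_homI:
  assumes "\<And>x. x \<in> carrier M \<Longrightarrow> h x \<in> carrier N"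
    and "\<And>x y. x \<in> carrier M \<Longrightarrow> y \<in> carrier M \<Longrightarrow> h (x \<oplus>\<^bsub>M\<^esub> y) = h x \<oplus>\<^bsub>N\<^esub> h y"
    and "\<And>a x. a \<in> carrier R \<Longrightarrow> x \<in> carrier M \<Longrightarrow> h (a \<odot>\<^bsub>M\<^esub> x) = a \<odot>\<^bsub>N\<^esub> h x"
  shows "h \<in> module_hom R M N"
  using assms by (auto simp: module_hom_def)

lemma module_hom_closed: "h \<in> module_hom R M N \<Longrightarrow> x \<in> carrier M \<Longrightarrow> h x \<in> carrier N"
  by (auto simp: module_hom_def)

lemma module_hom_add:
  "h \<in> module_hom R M N \<Longrightarrow> x \<in> carrier M \<Longrightarrow> y \<in> carrier M \<Longrightarrow> h (x \<oplus>\<^bsub>M\<^esub> y) = h x \<oplus>\<^bsub>N\<^esub> h y"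
  by (auto simp: module_hom_def)

lemma module_hom_smult:
  "h \<in> module_hom R M N \<Longrightarrow> a \<in> carrier R \<Longrightarrow> x \<in> carrier M \<Longrightarrow> h (a \<odot>\<^bsub>M\<^esub> x) = a \<odot>\<^bsub>N\<^esub> h x"
  by (auto simp: module_hom_def)

lemma module_hom_zero:
  assumes "module R M" "module R N" "h \<in> module_hom R M N"
  shows "h \<zero>\<^bsub>M\<^esub> = \<zero>\<^bsub>N\<^esub>"
proof -
  interpret M: module R M by fact
  interpret N: module R N by fact
  have "h (\<zero>\<^bsub>R\<^esub> \<odot>\<^bsub>M\<^esub> \<zero>\<^bsub>M\<^esub>) = \<zero>\<^bsub>R\<^esub> \<odot>\<^bsub>N\<^esub> h \<zero>\<^bsub>M\<^esub>"
    using assms(3) by (rule module_hom_smult) auto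
  then show ?thesis
    using module_hom_closed[OF assms(3)] by simp
qed

lemma module_hom_minus:
  assumes "module R M" "module R N" "h \<in> module_hom R M N"
    and "x \<in> carrier M" "y \<in> carrier M"
  shows "h (x \<ominus>\<^bsub>M\<^esub> y) = h x \<ominus>\<^bsub>N\<^esub> h y"
proof -
  interpret M: module R M by fact
  interpret N: module R N by fact
  have "h (x \<ominus>\<^bsub>M\<^esub> y) \<oplus>\<^bsub>N\<^esub> h y = h x"
    using assms by (simp flip: module_hom_add[OF assms(3)] add: M.M.minus_eq M.M.a_assoc M.M.l_neg)
  moreover have "h x \<in> carrier N" "h y \<in> carrier N" "h (x \<ominus>\<^bsub>M\<^esub> y) \<in> carrier N"
    using assms by (auto intro!: module_hom_closed[OF assms(3)])
  ultimately show ?thesis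
    by (metis N.M.minus_eq N.M.a_assoc N.M.r_neg N.M.r_zero N.M.a_inv_closed)
qed

lemma module_hom_comp:
  assumes "h \<in> module_hom R M N" "g \<in> module_hom R N P"
  shows "(\<lambda>x. g (h x)) \<in> module_hom R M P"
  using assms by (auto simp: module_hom_def Pi_iff)

lemma module_hom_id: "(\<lambda>x. x) \<in> module_hom R M M"
  by (auto simp: module_hom_def)

lemma module_hom_const_zero:
  assumes "module R N"
  shows "(\<lambda>x. \<zero>\<^bsub>N\<^esub>) \<in> module_hom R M N"
proof -
  interpret N: module R N by fact
  show ?thesis by (auto simp: module_hom_def)
qed

lemma module_hom_plus:
  assumes "module R N" "h \<in> module_hom R M N" "g \<in> module_hom R M N"
  shows "(\<lambda>x. h x \<oplus>\<^bsub>N\<^esub> g x) \<in> module_hom R M N"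
proof -
  interpret N: module R N by fact
  show ?thesis using assms
    by (intro module_homI)
      (auto simp: module_hom_closed module_hom_add module_hom_smult N.smult_r_distr N.M.add.m_ac)
qed

lemma module_hom_scale:
  assumes "module R N" "h \<in> module_hom R M N" "s \<in> carrier R"
  shows "(\<lambda>x. s \<odot>\<^bsub>N\<^esub> h x) \<in> module_hom R M N"
proof -
  interpret N: module R N by fact
  show ?thesis using assms
    by (intro module_homI)
      (auto simp: module_hom_closed module_hom_add module_hom_smult N.smult_r_distr
        N.smult_assoc1[symmetric] N.R.m_comm)
qed

lemma module_hom_diff:
  assumes "module R N" "h \<in> module_hom R M N" "g \<in> module_hom R M N"
  shows "(\<lambda>x. h x \<ominus>\<^bsub>N\<^esub> g x) \<in> module_hom R M N"
proof -
  interpret N: module R N by fact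
  have add4: "(a \<oplus>\<^bsub>N\<^esub> b) \<ominus>\<^bsub>N\<^esub> (c \<oplus>\<^bsub>N\<^esub> d) = (a \<ominus>\<^bsub>N\<^esub> c) \<oplus>\<^bsub>N\<^esub> (b \<ominus>\<^bsub>N\<^esub> d)"
    if "a \<in> carrier N" "b \<in> carrier N" "c \<in> carrier N" "d \<in> carrier N" for a b c d
    using that by (simp add: N.M.minus_eq N.M.minus_add N.M.add.m_ac)
  show ?thesis
    by (rule module_homI)
      (simp_all add: module_hom_closed[OF assms(2)] module_hom_closed[OF assms(3)]
        module_hom_add[OF assms(2)] module_hom_add[OF assms(3)]
        module_hom_smult[OF assms(2)] module_hom_smult[OF assms(3)] add4[unfolded N.M.minus_eq]
        N.M.minus_eq N.smult_r_distr N.smult_r_minus)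
qed

lemma module_ker_submodule:
  assumes "module R M" "module R N" "h \<in> module_hom R M N"
  shows "submodule (module_ker M N h) R M"
proof -
  interpret M: module R M by fact
  interpret N: module R N by fact
  have neg: "h (\<ominus>\<^bsub>M\<^esub> a) = \<zero>\<^bsub>N\<^esub>" if "a \<in> carrier M" "h a = \<zero>\<^bsub>N\<^esub>" for a
    using module_hom_minus[OF assms M.M.zero_closed that(1)] that module_hom_zero[OF assms]
    by (simp add: M.M.minus_eq N.M.minus_eq)
  show ?thesis
    by (rule M.submoduleI)
      (auto simp: module_ker_def module_hom_zero[OF assms] module_hom_add[OF assms(3)]
        module_hom_smult[OF assms(3)] neg)
qed

lemma module_ker_module:
  assumes "module R M" "module R N" "h \<in> module_hom R M N"
  shows "module R (M\<lparr>carrier := module_ker M N h\<rparr>)"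
  using submodule.submodule_is_module[OF module_ker_submodule[OF assms] assms(1)] .

section \<open>Free modules\<close>

lemma free_module_simps [simp]:
  "carrier (free_module R n) = {..<n} \<rightarrow>\<^sub>E carrier R"
  "\<zero>\<^bsub>free_module R n\<^esub> = (\<lambda>i\<in>{..<n}. \<zero>\<^bsub>R\<^esub>)"
  "v \<oplus>\<^bsub>free_module R n\<^esub> w = (\<lambda>i\<in>{..<n}. v i \<oplus>\<^bsub>R\<^esub> w i)"
  "a \<odot>\<^bsub>free_module R n\<^esub> v = (\<lambda>i\<in>{..<n}. a \<otimes>\<^bsub>R\<^esub> v i)"
  by (auto simp: free_module_def)

lemma vec_eqI:
  assumes "v \<in> {..<n} \<rightarrow>\<^sub>E A" "w \<in> {..<n} \<rightarrow>\<^sub>E B" "\<And>i. i < n \<Longrightarrow> v i = w i"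
  shows "v = w"
  using assms by (intro PiE_ext[of v "{..<n}" "\<lambda>_. A \<union> B"]) auto

lemma (in cring) free_module_module: "module R (free_module R n)"
proof (rule moduleI)
  let ?F = "free_module R n"
  show "abelian_group ?F"
  proof (rule abelian_groupI)
    fix x assume x: "x \<in> carrier ?F"
    show "\<exists>y\<in>carrier ?F. y \<oplus>\<^bsub>?F\<^esub> x = \<zero>\<^bsub>?F\<^esub>"
    proof
      show "(\<lambda>i\<in>{..<n}. \<ominus> x i) \<in> carrier ?F" using x by (auto simp: PiE_iff)
      show "(\<lambda>i\<in>{..<n}. \<ominus> x i) \<oplus>\<^bsub>?F\<^esub> x = \<zero>\<^bsub>?F\<^esub>"
        using x by (auto simp: PiE_iff l_neg intro!: restrict_ext)
    qed
  qed (auto simp: PiE_iff a_ac extensional_def intro!: restrict_ext ext)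
qed (auto simp: PiE_iff is_cring l_distr r_distr m_assoc extensional_def intro!: restrict_ext ext is_cring)

definition unit_vec :: "('a, 'c) ring_scheme \<Rightarrow> nat \<Rightarrow> nat \<Rightarrow> nat \<Rightarrow> 'a" where
  "unit_vec R n k = (\<lambda>i\<in>{..<n}. if i = k then \<one>\<^bsub>R\<^esub> else \<zero>\<^bsub>R\<^esub>)"

lemma (in ring) unit_vec_closed: "unit_vec R n k \<in> carrier (free_module R n)"
  by (auto simp: unit_vec_def)

text \<open>Induction on the number \<open>m\<close> of leading coordinates outside of which the vector vanishes: splitting
  off the last of them as a multiple of a basis vector avoids finite sums in the free module.\<close>

lemma (in cring) hom_eq_on_basis:
  assumes "module R N" and h: "h \<in> module_hom R (free_module R n) N"
    and g: "g \<in> module_hom R (free_module R n) N"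
    and eq: "\<And>k. k < n \<Longrightarrow> h (unit_vec R n k) = g (unit_vec R n k)"
    and v: "v \<in> carrier (free_module R n)"
  shows "h v = g v"
proof -
  interpret N: module R N by fact
  let ?F = "free_module R n"
  interpret F: module R ?F by (rule free_module_module)
  have "h v = g v" if "m \<le> n" "v \<in> carrier ?F" "\<forall>i<n. m \<le> i \<longrightarrow> v i = \<zero>" for m v
    using that
  proof (induction m arbitrary: v)
    case 0
    then have "v = \<zero>\<^bsub>?F\<^esub>" by (intro vec_eqI[of v n]) auto
    then show ?case
      using module_hom_zero[OF F.module_axioms assms(1) h] module_hom_zero[OF F.module_axioms assms(1) g]
      by metis
  next
    case (Suc m)
    define w where "w = (\<lambda>i\<in>{..<n}. if i = m then \<zero> else v i)"
    have m: "m < n" and vm: "v m \<in> carrier R" and w: "w \<in> carrier ?F"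
      using Suc.prems by (auto simp: w_def PiE_iff)
    have e: "unit_vec R n m \<in> carrier ?F" by (rule unit_vec_closed)
    have "v = w \<oplus>\<^bsub>?F\<^esub> v m \<odot>\<^bsub>?F\<^esub> unit_vec R n m"
    proof (rule vec_eqI)
      show "v \<in> {..<n} \<rightarrow>\<^sub>E carrier R" using Suc.prems by simp
      show "w \<oplus>\<^bsub>?F\<^esub> v m \<odot>\<^bsub>?F\<^esub> unit_vec R n m \<in> {..<n} \<rightarrow>\<^sub>E carrier R"
        using F.M.a_closed[OF w F.smult_closed[OF vm e]] by simp
    qed (use Suc.prems m in \<open>auto simp: w_def unit_vec_def PiE_iff\<close>)
    moreover have "h w = g w"
      using Suc.prems w by (intro Suc.IH) (auto simp: w_def)
    moreover have "k (w \<oplus>\<^bsub>?F\<^esub> v m \<odot>\<^bsub>?F\<^esub> unit_vec R n m) = k w \<oplus>\<^bsub>N\<^esub> v m \<odot>\<^bsub>N\<^esub> k (unit_vec R n m)"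
      if "k \<in> module_hom R ?F N" for k
      using module_hom_add[OF that w F.smult_closed[OF vm e]] module_hom_smult[OF that vm e] by metis
    ultimately show ?case using h g eq[OF m] by metis
  qed
  from this[of n v] show ?thesis using v by simp
qed

lemma (in cring) hom_from_basis:
  assumes "module R N" and w: "\<And>k. k < n \<Longrightarrow> w k \<in> carrier N"
  obtains h where "h \<in> module_hom R (free_module R n) N" "\<And>k. k < n \<Longrightarrow> h (unit_vec R n k) = w k"
proof -
  interpret N: module R N by fact
  define h where "h v = (\<Oplus>\<^bsub>N\<^esub>k\<in>{..<n}. v k \<odot>\<^bsub>N\<^esub> w k)" for v
  have "h \<in> module_hom R (free_module R n) N"
  proof (rule module_homI)
    fix x y assume xy: "x \<in> carrier (free_module R n)" "y \<in> carrier (free_module R n)"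
    show "h x \<in> carrier N" using xy w by (auto simp: h_def PiE_iff intro!: N.M.finsum_closed)
    have "h (x \<oplus>\<^bsub>free_module R n\<^esub> y) = (\<Oplus>\<^bsub>N\<^esub>k\<in>{..<n}. x k \<odot>\<^bsub>N\<^esub> w k \<oplus>\<^bsub>N\<^esub> y k \<odot>\<^bsub>N\<^esub> w k)"
      unfolding h_def using xy w by (intro N.M.finsum_cong') (auto simp: PiE_iff N.smult_l_distr)
    also have "\<dots> = h x \<oplus>\<^bsub>N\<^esub> h y"
      unfolding h_def using xy w by (intro N.M.finsum_addf) (auto simp: PiE_iff)
    finally show "h (x \<oplus>\<^bsub>free_module R n\<^esub> y) = h x \<oplus>\<^bsub>N\<^esub> h y" .
  next
    fix a x assume ax: "a \<in> carrier R" "x \<in> carrier (free_module R n)"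
    have "h (a \<odot>\<^bsub>free_module R n\<^esub> x) = (\<Oplus>\<^bsub>N\<^esub>k\<in>{..<n}. a \<odot>\<^bsub>N\<^esub> (x k \<odot>\<^bsub>N\<^esub> w k))"
      unfolding h_def using ax w by (intro N.M.finsum_cong') (auto simp: PiE_iff N.smult_assoc1)
    also have "\<dots> = a \<odot>\<^bsub>N\<^esub> h x"
      unfolding h_def using ax w by (intro N.finsum_smult_ldistr[symmetric]) (auto simp: PiE_iff)
    finally show "h (a \<odot>\<^bsub>free_module R n\<^esub> x) = a \<odot>\<^bsub>N\<^esub> h x" .
  qed
  moreover have "h (unit_vec R n k) = w k" if "k < n" for k
  proof -
    have "h (unit_vec R n k) = (\<Oplus>\<^bsub>N\<^esub>j\<in>{..<n}. if k = j then w j else \<zero>\<^bsub>N\<^esub>)"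
      unfolding h_def using w by (intro N.M.finsum_cong') (auto simp: unit_vec_def)
    also have "\<dots> = w k"
      using that w by (intro N.M.finsum_singleton) auto
    finally show ?thesis .
  qed
  ultimately show ?thesis by (rule that)
qed

lemma (in cring) free_module_lift:
  assumes "module R N" "module R N'" and g: "g \<in> module_hom R N N'"
    and h: "h \<in> module_hom R (free_module R n) N'"
    and sub: "h ` carrier (free_module R n) \<subseteq> g ` carrier N"
  obtains k where "k \<in> module_hom R (free_module R n) N"
    and "\<And>x. x \<in> carrier (free_module R n) \<Longrightarrow> g (k x) = h x"
proof -
  have "\<exists>y\<in>carrier N. g y = h (unit_vec R n k)" for k
    using sub unit_vec_closed[of n k] by (metis imageE image_subset_iff)
  then obtain w where w: "\<And>k. w k \<in> carrier N" "\<And>k. g (w k) = h (unit_vec R n k)" by metis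
  obtain k where k: "k \<in> module_hom R (free_module R n) N" "\<And>i. i < n \<Longrightarrow> k (unit_vec R n i) = w i"
    using hom_from_basis[OF assms(1), where w = w and n = n] w(1) by blast
  have "g (k x) = h x" if "x \<in> carrier (free_module R n)" for x
    by (rule hom_eq_on_basis[OF assms(2) module_hom_comp[OF k(1) g] h _ that]) (simp add: k w)
  with k(1) show ?thesis by (rule that)
qed

lemma (in cring) free_module_projective: "projective_module R (free_module R n)"
proof -
  have "\<exists>k\<in>module_hom R (free_module R n) N. \<forall>x\<in>carrier (free_module R n). g (k x) = h x"
    if "module R N" "module R N'" "g \<in> module_hom R N N'" "g ` carrier N = carrier N'"
      and h: "h \<in> module_hom R (free_module R n) N'"
    for N N' :: "('a, (nat \<Rightarrow> 'a) \<Rightarrow> 'a) module" and g h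
  proof -
    have "h ` carrier (free_module R n) \<subseteq> g ` carrier N"
      using module_hom_closed[OF h] that(4) by blast
    from free_module_lift[OF that(1-3) h this] show ?thesis by metis
  qed
  then show ?thesis unfolding projective_module_def using free_module_module by blast
qed

section \<open>Chain conditions\<close>

lemma (in noetherian_ring) ideal_chain_stabilizes:
  assumes "\<And>k. ideal (J k) R" and mono: "\<And>k::nat. J k \<subseteq> J (Suc k)"
  shows "\<exists>k. \<forall>m\<ge>k. J m = J k"
proof -
  have le: "J k \<subseteq> J m" if "k \<le> m" for k m
    using lift_Suc_mono_le[of J, OF mono that] .
  have "subset.chain {I. ideal I R} (range J)"
    unfolding subset_chain_def using assms(1) le nat_le_linear by blast
  then have "\<Union>(range J) \<in> range J"
    by (intro ideal_chain_is_trivial) auto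
  then obtain k where k: "\<Union>(range J) = J k" by auto
  have "J m = J k" if "m \<ge> k" for m
    using le[OF that] k by blast
  then show ?thesis by blast
qed

text \<open>A chain of ideals contains its union, so that Zorn's lemma applies to any set of ideals, even one that
  is not closed under unions.\<close>

lemma (in noetherian_ring) exists_maximal_ideal_in:
  assumes "\<I> \<noteq> {}" "\<And>I. I \<in> \<I> \<Longrightarrow> ideal I R"
  shows "\<exists>I\<in>\<I>. \<forall>J\<in>\<I>. I \<subseteq> J \<longrightarrow> J = I"
proof (rule subset_Zorn_nonempty)
  fix C assume C: "C \<noteq> {}" "subset.chain \<I> C"
  then have "subset.chain {I. ideal I R} C"
    using assms(2) by (auto simp: subset_chain_def)
  then show "\<Union>C \<in> \<I>"
    using ideal_chain_is_trivial[OF C(1)] C(2) by (auto simp: subset_chain_def)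
qed fact

text \<open>Induction on the rank: a submodule \<open>N\<close> of \<open>R\<^bsup>n+1\<^esup>\<close> is
  controlled by the ideal of its last coordinates and by the submodule of \<open>R\<^sup>n\<close> formed by its vectors
  with last coordinate \<open>0\<close>: nested submodules that agree in both are equal.\<close>

lemma free_submodule_chain_stabilizes:
  fixes R (structure)
  assumes "cring R" "noetherian_ring R"
    and "\<And>k. submodule (N k) R (free_module R n)" and "\<And>k::nat. N k \<subseteq> N (Suc k)"
  shows "\<exists>k. \<forall>m\<ge>k. N m = N k"
  using assms(3,4)
proof (induction n arbitrary: N)
  interpret cring R by fact
  case 0
  interpret F: module R "free_module R 0" by (rule free_module_module)
  have "N k = {\<lambda>_. undefined}" for k
    using F.submoduleE(1,2)[OF "0.prems"(1)[of k]] by auto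
  then show ?case by blast
next
  interpret cring R by fact
  interpret noetherian_ring R by fact
  case (Suc n)
  let ?F = "free_module R (Suc n)" and ?G = "free_module R n"
  interpret F: module R ?F by (rule free_module_module)
  interpret G: module R ?G by (rule free_module_module)
  have NF: "v \<in> carrier ?F" if "v \<in> N k" for v k
    using F.submoduleE(1)[OF Suc.prems(1)[of k]] that by blast
  have zero: "\<zero>\<^bsub>?F\<^esub> \<in> N k" for k
    using submodule.axioms(1)[OF Suc.prems(1)[of k]] subgroup.one_closed by fastforce
  have sm: "a \<odot>\<^bsub>?F\<^esub> v \<in> N k" if "a \<in> carrier R" "v \<in> N k" for a v k
    using F.submoduleE(4)[OF Suc.prems(1)] that .
  have pl: "v \<oplus>\<^bsub>?F\<^esub> w \<in> N k" if "v \<in> N k" "w \<in> N k" for v w k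
    using F.submoduleE(5)[OF Suc.prems(1)] that .
  define J where "J k = (\<lambda>v. v n) ` N k" for k
  define N' where "N' k = (\<lambda>v. restrict v {..<n}) ` {v \<in> N k. v n = \<zero>}" for k
  have "ideal (J k) R" for k
  proof (rule idealI)
    show "ring R" by (rule ring_axioms)
    have mult: "b \<otimes> a \<in> J k" if "a \<in> J k" "b \<in> carrier R" for a b
    proof -
      from that(1) obtain v where v: "v \<in> N k" "a = v n" by (auto simp: J_def)
      show ?thesis
        unfolding J_def
        by (rule image_eqI[of _ _ "b \<odot>\<^bsub>?F\<^esub> v"]) (use v(2) sm[OF that(2) v(1)] in simp_all)
    qed
    have sub: "J k \<subseteq> carrier R" using NF by (fastforce simp: J_def)
    show "subgroup (J k) (add_monoid R)"
    proof (rule add.subgroupI)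
      show "J k \<noteq> {}" using zero by (auto simp: J_def)
      show "\<ominus> a \<in> J k" if "a \<in> J k" for a
        using mult[OF that, of "\<ominus> \<one>"] sub that by (auto simp: l_minus)
      show "a \<oplus> b \<in> J k" if "a \<in> J k" "b \<in> J k" for a b
      proof -
        from that obtain v w where v: "v \<in> N k" "a = v n" and w: "w \<in> N k" "b = w n"
          by (auto simp: J_def)
        show ?thesis
          unfolding J_def
          by (rule image_eqI[of _ _ "v \<oplus>\<^bsub>?F\<^esub> w"]) (use v(2) w(2) pl[OF v(1) w(1)] in simp_all)
      qed
    qed (rule sub)
    show "b \<otimes> a \<in> J k" "a \<otimes> b \<in> J k" if "a \<in> J k" "b \<in> carrier R" for a b
      using mult[OF that] sub that by (auto simp: m_comm)
  qed
  moreover have "J k \<subseteq> J (Suc k)" for k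
    using Suc.prems(2) by (auto simp: J_def)
  ultimately obtain k1 where k1: "\<And>m. m \<ge> k1 \<Longrightarrow> J m = J k1"
    using ideal_chain_stabilizes[of J] by blast
  have "submodule (N' k) R ?G" for k
  proof (rule G.submoduleI)
    show "N' k \<subseteq> carrier ?G" using NF by (fastforce simp: N'_def)
    show z: "\<zero>\<^bsub>?G\<^esub> \<in> N' k"
      unfolding N'_def by (rule image_eqI[where x = "\<zero>\<^bsub>?F\<^esub>"]) (use zero in \<open>auto intro!: ext\<close>)
    fix x y assume "x \<in> N' k" "y \<in> N' k"
    then obtain v w where v: "v \<in> N k" "v n = \<zero>" "x = restrict v {..<n}"
      and w: "w \<in> N k" "w n = \<zero>" "y = restrict w {..<n}" by (auto simp: N'_def)
    show "x \<oplus>\<^bsub>?G\<^esub> y \<in> N' k"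
      unfolding N'_def
      by (rule image_eqI[where x = "v \<oplus>\<^bsub>?F\<^esub> w"]) (use v w pl[OF v(1) w(1)] in \<open>auto intro!: ext\<close>)
  next
    fix a x assume "a \<in> carrier R" "x \<in> N' k"
    then obtain v where v: "v \<in> N k" "v n = \<zero>" "x = restrict v {..<n}" by (auto simp: N'_def)
    show "a \<odot>\<^bsub>?G\<^esub> x \<in> N' k"
      unfolding N'_def
      by (rule image_eqI[where x = "a \<odot>\<^bsub>?F\<^esub> v"]) (use v sm[OF \<open>a \<in> carrier R\<close> v(1)] \<open>a \<in> carrier R\<close> in \<open>auto intro!: ext\<close>)
  next
    fix x assume "x \<in> N' k"
    then obtain v where v: "v \<in> N k" "v n = \<zero>" "x = restrict v {..<n}" by (auto simp: N'_def)
    have x: "x \<in> carrier ?G" using v NF by fastforce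
    have "\<ominus>\<^bsub>?G\<^esub> x = (\<ominus> \<one>) \<odot>\<^bsub>?G\<^esub> x"
      using G.smult_l_minus[OF one_closed x] G.smult_one[OF x] by simp
    also have "\<dots> \<in> N' k"
      unfolding N'_def
      by (rule image_eqI[where x = "(\<ominus> \<one>) \<odot>\<^bsub>?F\<^esub> v"]) (use v sm[of "\<ominus> \<one>", OF _ v(1)] in \<open>auto intro!: ext\<close>)
    finally show "\<ominus>\<^bsub>?G\<^esub> x \<in> N' k" .
  qed
  moreover have "N' k \<subseteq> N' (Suc k)" for k
    using Suc.prems(2) by (auto simp: N'_def)
  ultimately obtain k2 where k2: "\<And>m. m \<ge> k2 \<Longrightarrow> N' m = N' k2"
    using Suc.IH[of N'] by blast
  define k where "k = max k1 k2"
  have le: "N k \<subseteq> N m" if "k \<le> m" for k m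
    using lift_Suc_mono_le[of N, OF Suc.prems(2) that] .
  have "N m \<subseteq> N k" if "m \<ge> k" for m
  proof
    fix v assume v: "v \<in> N m"
    have "J m = J k" "N' m = N' k"
      using k1[of m] k1[of k] k2[of m] k2[of k] that by (auto simp: k_def)
    with v obtain w where w: "w \<in> N k" "w n = v n" by (force simp: J_def)
    let ?d = "v \<oplus>\<^bsub>?F\<^esub> (\<ominus> \<one>) \<odot>\<^bsub>?F\<^esub> w"
    have wm: "w \<in> N m" using le[OF that] w(1) by blast
    have vF: "v \<in> carrier ?F" and wF: "w \<in> carrier ?F" using NF v w(1) by auto
    have d: "?d \<in> N m" using pl[OF v sm[OF _ wm]] by simp
    have dn: "?d n = \<zero>"
      using vF wF w(2) by (auto simp: PiE_iff l_minus r_neg)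
    from d dn have "restrict ?d {..<n} \<in> N' m" unfolding N'_def by blast
    then obtain u where u: "u \<in> N k" "u n = \<zero>" "restrict ?d {..<n} = restrict u {..<n}"
      using \<open>N' m = N' k\<close> by (auto simp: N'_def)
    have uF: "u \<in> carrier ?F" using NF u(1) by auto
    have ui: "u i = v i \<oplus> \<ominus> w i" if "i < n" for i
      using fun_cong[OF u(3), of i] that vF wF by (auto simp: PiE_iff l_minus)
    have "v = u \<oplus>\<^bsub>?F\<^esub> w"
    proof (rule vec_eqI)
      show "v \<in> {..<Suc n} \<rightarrow>\<^sub>E carrier R" using vF by simp
      show "u \<oplus>\<^bsub>?F\<^esub> w \<in> {..<Suc n} \<rightarrow>\<^sub>E carrier R" using F.M.a_closed[OF uF wF] by simp
      fix i assume "i < Suc n"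
      moreover from this have "v i \<in> carrier R" "w i \<in> carrier R" using vF wF by auto
      ultimately show "v i = (u \<oplus>\<^bsub>?F\<^esub> w) i"
        by (cases "i = n") (use u w ui in \<open>auto simp: a_assoc l_neg\<close>)
    qed
    with pl[OF u(1) w(1)] show "v \<in> N k" by simp
  qed
  then show ?case using le by (intro exI[of _ k]) blast
qed

text \<open>Almost surjective implies almost injective.\<close>

text \<open>For \<open>s = 1\<close> this says that a surjective endomorphism of a noetherian module is injective, and the proof
  is the same. The kernels of the powers of \<open>h\<close> stabilize, say at \<open>k\<close>. If \<open>h z = 0\<close>, write
  \<open>s\<^sup>k z = h\<^sup>k w\<close>; then \<open>w\<close> lies in the kernel of \<open>h\<^bsup>k+1\<^esup>\<close>, hence in that of \<open>h\<^sup>k\<close>, and \<open>s\<^sup>k z = 0\<close>.\<close>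

lemma almost_surjective_endo_kernel:
  fixes R (structure)
  assumes "cring R" "noetherian_ring R"
    and h: "h \<in> module_hom R (free_module R n) (free_module R n)"
    and s: "s \<in> carrier R"
    and surj: "\<And>v. v \<in> carrier (free_module R n) \<Longrightarrow>
       \<exists>w\<in>carrier (free_module R n). h w = s \<odot>\<^bsub>free_module R n\<^esub> v"
    and z: "z \<in> carrier (free_module R n)" "h z = \<zero>\<^bsub>free_module R n\<^esub>"
  shows "\<exists>k::nat. (s [^]\<^bsub>R\<^esub> k) \<odot>\<^bsub>free_module R n\<^esub> z = \<zero>\<^bsub>free_module R n\<^esub>"
proof -
  interpret cring R by fact
  let ?F = "free_module R n"
  interpret F: module R ?F by (rule free_module_module)
  have hk: "(h ^^ k) \<in> module_hom R ?F ?F" for k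
  proof (induction k)
    case (Suc k)
    show ?case using module_hom_comp[OF Suc h] by (simp add: comp_def)
  qed (use module_hom_id in \<open>simp add: id_def\<close>)
  have h0: "h \<zero>\<^bsub>?F\<^esub> = \<zero>\<^bsub>?F\<^esub>" by (rule module_hom_zero[OF F.module_axioms F.module_axioms h])
  have "\<exists>k. \<forall>m\<ge>k. module_ker ?F ?F (h ^^ m) = module_ker ?F ?F (h ^^ k)"
  proof (rule free_submodule_chain_stabilizes[OF assms(1,2)])
    show "submodule (module_ker ?F ?F (h ^^ k)) R ?F" for k
      by (rule module_ker_submodule[OF F.module_axioms F.module_axioms hk])
    show "module_ker ?F ?F (h ^^ k) \<subseteq> module_ker ?F ?F (h ^^ Suc k)" for k
      using h0 unfolding module_ker_def by (auto simp del: free_module_simps)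
  qed
  then obtain k where k: "\<And>m. m \<ge> k \<Longrightarrow> module_ker ?F ?F (h ^^ m) = module_ker ?F ?F (h ^^ k)"
    by blast
  have "\<exists>w\<in>carrier ?F. (h ^^ j) w = (s [^] j) \<odot>\<^bsub>?F\<^esub> v" if "v \<in> carrier ?F" for j v
    using that
  proof (induction j arbitrary: v)
    case 0
    then show ?case using F.smult_one by (intro bexI[of _ v]) (simp_all del: free_module_simps)
  next
    case (Suc j)
    obtain u where u: "u \<in> carrier ?F" "h u = s \<odot>\<^bsub>?F\<^esub> v" using surj[OF Suc.prems] by blast
    obtain w where w: "w \<in> carrier ?F" "(h ^^ j) w = (s [^] j) \<odot>\<^bsub>?F\<^esub> u"
      using Suc.IH[OF u(1)] by blast
    have "(h ^^ Suc j) w = h ((s [^] j) \<odot>\<^bsub>?F\<^esub> u)" using w by simp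
    also have "\<dots> = (s [^] j) \<odot>\<^bsub>?F\<^esub> (s \<odot>\<^bsub>?F\<^esub> v)"
      using module_hom_smult[OF h nat_pow_closed[OF s] u(1)] u(2) by metis
    also have "\<dots> = (s [^] Suc j) \<odot>\<^bsub>?F\<^esub> v"
      using F.smult_assoc1[OF nat_pow_closed[OF s] s Suc.prems] by simp
    finally show ?case using w(1) by blast
  qed
  from this[OF z(1), of k] obtain w where w: "w \<in> carrier ?F" "(h ^^ k) w = (s [^] k) \<odot>\<^bsub>?F\<^esub> z"
    by blast
  have "(h ^^ Suc k) w = (s [^] k) \<odot>\<^bsub>?F\<^esub> \<zero>\<^bsub>?F\<^esub>"
    using w(2) module_hom_smult[OF h nat_pow_closed[OF s] z(1)] z(2) by simp
  then have "w \<in> module_ker ?F ?F (h ^^ Suc k)"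
    using w(1) F.smult_r_null[OF nat_pow_closed[OF s]] unfolding module_ker_def by simp
  then have "(h ^^ k) w = \<zero>\<^bsub>?F\<^esub>"
    using k[of "Suc k"] unfolding module_ker_def by auto
  with w(2) show ?thesis by metis
qed

section \<open>Block vectors\<close>

text \<open>The isomorphism of \<open>R\<^sup>c \<oplus> R\<^sup>b\<close> with \<open>R\<^bsup>c+b\<^esup>\<close>, whose inverse consists of the restriction to \<open>{..<c}\<close> and
  of \<open>vdrop\<close>.\<close>

definition vappend :: "nat \<Rightarrow> nat \<Rightarrow> (nat \<Rightarrow> 'a) \<Rightarrow> (nat \<Rightarrow> 'a) \<Rightarrow> nat \<Rightarrow> 'a" where
  "vappend c b v w = (\<lambda>k\<in>{..<c + b}. if k < c then v k else w (k - c))"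

definition vdrop :: "nat \<Rightarrow> nat \<Rightarrow> (nat \<Rightarrow> 'a) \<Rightarrow> nat \<Rightarrow> 'a" where
  "vdrop c b v = (\<lambda>k\<in>{..<b}. v (c + k))"

lemma restrict_hom:
  assumes "m \<le> n"
  shows "(\<lambda>v. restrict v {..<m}) \<in> module_hom R (free_module R n) (free_module R m)"
  using assms by (intro module_homI) (auto simp: PiE_iff intro!: ext)

lemma vdrop_hom: "vdrop c b \<in> module_hom R (free_module R (c + b)) (free_module R b)"
  by (intro module_homI) (auto simp: vdrop_def PiE_iff intro!: ext)

lemma vappend_closed:
  assumes "v \<in> carrier (free_module R c)" "w \<in> carrier (free_module R b)"
  shows "vappend c b v w \<in> carrier (free_module R (c + b))"
  using assms by (auto simp: vappend_def PiE_iff)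

lemma vappend_hom:
  assumes "f \<in> module_hom R X (free_module R c)" "g \<in> module_hom R X (free_module R b)"
  shows "(\<lambda>x. vappend c b (f x) (g x)) \<in> module_hom R X (free_module R (c + b))"
proof (rule module_homI)
  fix x assume "x \<in> carrier X"
  then show "vappend c b (f x) (g x) \<in> carrier (free_module R (c + b))"
    by (intro vappend_closed module_hom_closed[OF assms(1)] module_hom_closed[OF assms(2)])
next
  fix x y assume "x \<in> carrier X" "y \<in> carrier X"
  then show "vappend c b (f (x \<oplus>\<^bsub>X\<^esub> y)) (g (x \<oplus>\<^bsub>X\<^esub> y)) =
      vappend c b (f x) (g x) \<oplus>\<^bsub>free_module R (c + b)\<^esub> vappend c b (f y) (g y)"
    by (auto simp: module_hom_add[OF assms(1)] module_hom_add[OF assms(2)] vappend_def intro!: ext)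
next
  fix a x assume "a \<in> carrier R" "x \<in> carrier X"
  then show "vappend c b (f (a \<odot>\<^bsub>X\<^esub> x)) (g (a \<odot>\<^bsub>X\<^esub> x)) =
      a \<odot>\<^bsub>free_module R (c + b)\<^esub> vappend c b (f x) (g x)"
    by (auto simp: module_hom_smult[OF assms(1)] module_hom_smult[OF assms(2)] vappend_def intro!: ext)
qed

lemma restrict_vappend: "v \<in> carrier (free_module R c) \<Longrightarrow> restrict (vappend c b v w) {..<c} = v"
  by (rule vec_eqI[where B = "carrier R" and A = "carrier R" and n = c]) (auto simp: vappend_def PiE_iff)

lemma vdrop_vappend: "w \<in> carrier (free_module R b) \<Longrightarrow> vdrop c b (vappend c b v w) = w"
  by (rule vec_eqI[where B = "carrier R" and A = "carrier R" and n = b]) (auto simp: vappend_def vdrop_def PiE_iff)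

lemma vappend_restrict_vdrop:
  "v \<in> carrier (free_module R (c + b)) \<Longrightarrow> vappend c b (restrict v {..<c}) (vdrop c b v) = v"
  by (rule vec_eqI[where B = "carrier R" and A = "carrier R" and n = "c + b"])
    (auto simp: vappend_def vdrop_def PiE_iff)

lemma vappend_smult:
  "vappend c b (a \<odot>\<^bsub>free_module R c\<^esub> v) (a \<odot>\<^bsub>free_module R b\<^esub> w) =
     a \<odot>\<^bsub>free_module R (c + b)\<^esub> vappend c b v w"
  by (auto simp: vappend_def intro!: ext)

lemma vappend_add:
  "vappend c b v w \<oplus>\<^bsub>free_module R (c + b)\<^esub> vappend c b v' w' =
     vappend c b (v \<oplus>\<^bsub>free_module R c\<^esub> v') (w \<oplus>\<^bsub>free_module R b\<^esub> w')"
  by (auto simp: vappend_def intro!: ext)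

section \<open>Stable freeness up to a scalar\<close>

text \<open>The row \<open>(\<alpha>\<^sub>1, \<alpha>\<^sub>2)\<close> and the column \<open>(\<beta>\<^sub>1, \<beta>\<^sub>2)\<close> are maps between \<open>Z \<oplus> R\<^sup>b\<close> and \<open>R\<^sup>a\<close> whose two compositions are
  multiplication by \<open>s\<close>; the conditions are the entries of these compositions. After inverting \<open>s\<close> the two
  modules become isomorphic. Writing out the entries avoids a direct sum, which would need a
  type of its own for each \<open>Z\<close>.\<close>

definition stably_free_up_to ::
  "('a, 'c) ring_scheme \<Rightarrow> 'a \<Rightarrow> ('a, 'b, 'd) module_scheme \<Rightarrow> nat \<Rightarrow> nat \<Rightarrow> bool" where
  "stably_free_up_to R s Z a b \<longleftrightarrow>
     (\<exists>\<alpha>\<^sub>1 \<in> module_hom R Z (free_module R a). \<exists>\<alpha>\<^sub>2 \<in> module_hom R (free_module R b) (free_module R a).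
      \<exists>\<beta>\<^sub>1 \<in> module_hom R (free_module R a) Z. \<exists>\<beta>\<^sub>2 \<in> module_hom R (free_module R a) (free_module R b).
        (\<forall>z\<in>carrier Z. \<beta>\<^sub>1 (\<alpha>\<^sub>1 z) = s \<odot>\<^bsub>Z\<^esub> z \<and> \<beta>\<^sub>2 (\<alpha>\<^sub>1 z) = \<zero>\<^bsub>free_module R b\<^esub>) \<and>
        (\<forall>w\<in>carrier (free_module R b). \<beta>\<^sub>1 (\<alpha>\<^sub>2 w) = \<zero>\<^bsub>Z\<^esub> \<and> \<beta>\<^sub>2 (\<alpha>\<^sub>2 w) = s \<odot>\<^bsub>free_module R b\<^esub> w) \<and>
        (\<forall>u\<in>carrier (free_module R a). \<alpha>\<^sub>1 (\<beta>\<^sub>1 u) \<oplus>\<^bsub>free_module R a\<^esub> \<alpha>\<^sub>2 (\<beta>\<^sub>2 u) = s \<odot>\<^bsub>free_module R a\<^esub> u))"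

lemma stably_free_up_to_zero:
  assumes "module R Z" "s \<in> carrier R" and kill: "\<And>z. z \<in> carrier Z \<Longrightarrow> s \<odot>\<^bsub>Z\<^esub> z = \<zero>\<^bsub>Z\<^esub>"
  shows "stably_free_up_to R s Z 0 0"
proof -
  interpret Z: module R Z by fact
  let ?O = "free_module R 0"
  interpret O: module R ?O by (rule Z.free_module_module)
  have *: "v = \<zero>\<^bsub>?O\<^esub>" if "v \<in> carrier ?O" for v using that by (auto intro!: ext)
  show ?thesis
    unfolding stably_free_up_to_def
    by (rule bexI[of _ "\<lambda>_. \<zero>\<^bsub>?O\<^esub>"], rule bexI[of _ "\<lambda>_. \<zero>\<^bsub>?O\<^esub>"], rule bexI[of _ "\<lambda>_. \<zero>\<^bsub>Z\<^esub>"],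
        rule bexI[of _ "\<lambda>_. \<zero>\<^bsub>?O\<^esub>"])
      (auto intro!: module_hom_const_zero Z.module_axioms O.module_axioms dest!: * simp: kill assms(2) simp del: free_module_simps)
qed

lemma kernel_module_simps:
  fixes R :: "('a, 'c) ring_scheme" and Z :: "('a, 'b, 'd) module_scheme"
    and c :: nat and \<pi> :: "(nat \<Rightarrow> 'a) \<Rightarrow> 'b"
  defines "K \<equiv> (free_module R c)\<lparr>carrier := module_ker (free_module R c) Z \<pi>\<rparr>"
  shows "\<zero>\<^bsub>K\<^esub> = \<zero>\<^bsub>free_module R c\<^esub>"
    and "v \<oplus>\<^bsub>K\<^esub> w = v \<oplus>\<^bsub>free_module R c\<^esub> w"
    and "r \<odot>\<^bsub>K\<^esub> v = r \<odot>\<^bsub>free_module R c\<^esub> v"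
    and "v \<in> carrier K \<longleftrightarrow> v \<in> carrier (free_module R c) \<and> \<pi> v = \<zero>\<^bsub>Z\<^esub>"
  by (auto simp: K_def module_ker_def)

text \<open>If a map \<open>\<pi>\<close> has a section \<open>\<sigma>\<close> up to the scalar \<open>y\<close>, then \<open>v \<mapsto> y v - \<sigma> (\<pi> v)\<close> projects onto
  the kernel of \<open>\<pi>\<close> up to \<open>y\<close>.\<close>

lemma projection_along_section:
  fixes R (structure)
  assumes "module R Z"
    and \<pi>: "\<pi> \<in> module_hom R (free_module R c) Z"
    and \<sigma>: "\<sigma> \<in> module_hom R Z (free_module R c)"
    and y: "y \<in> carrier R"
    and sec: "\<And>z. z \<in> carrier Z \<Longrightarrow> \<pi> (\<sigma> z) = y \<odot>\<^bsub>Z\<^esub> z"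
  defines "K \<equiv> (free_module R c)\<lparr>carrier := module_ker (free_module R c) Z \<pi>\<rparr>"
  obtains \<rho> where "\<rho> \<in> module_hom R (free_module R c) K"
    and "\<And>v. v \<in> carrier K \<Longrightarrow> \<rho> v = y \<odot>\<^bsub>K\<^esub> v"
    and "\<And>z. z \<in> carrier Z \<Longrightarrow> \<rho> (\<sigma> z) = \<zero>\<^bsub>K\<^esub>"
    and "\<And>v. v \<in> carrier (free_module R c) \<Longrightarrow>
      \<rho> v \<oplus>\<^bsub>free_module R c\<^esub> \<sigma> (\<pi> v) = y \<odot>\<^bsub>free_module R c\<^esub> v"
proof -
  interpret Z: module R Z by fact
  let ?C = "free_module R c"
  interpret C: module R ?C by (rule Z.free_module_module)
  note [simp del] = free_module_simps
  note [simp] = module_hom_closed[OF \<pi>] module_hom_closed[OF \<sigma>]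
    module_hom_zero[OF Z.module_axioms C.module_axioms \<sigma>]
  note K_simps = kernel_module_simps[where R = R and Z = Z and c = c and \<pi> = \<pi>, folded K_def]
  define \<rho> where "\<rho> v = y \<odot>\<^bsub>?C\<^esub> v \<ominus>\<^bsub>?C\<^esub> \<sigma> (\<pi> v)" for v
  have \<rho>C: "\<rho> \<in> module_hom R ?C ?C"
    unfolding \<rho>_def
    by (intro module_hom_diff module_hom_scale module_hom_id module_hom_comp[OF \<pi> \<sigma>] C.module_axioms y)
  show ?thesis
  proof (rule that)
    show "\<rho> \<in> module_hom R ?C K"
    proof (rule module_homI)
      fix v assume v: "v \<in> carrier ?C"
      have "\<pi> (\<rho> v) = y \<odot>\<^bsub>Z\<^esub> \<pi> v \<ominus>\<^bsub>Z\<^esub> y \<odot>\<^bsub>Z\<^esub> \<pi> v"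
        unfolding \<rho>_def using v y
        by (simp add: module_hom_minus[OF C.module_axioms Z.module_axioms \<pi>] module_hom_smult[OF \<pi>] sec)
      then show "\<rho> v \<in> carrier K"
        using v y module_hom_closed[OF \<rho>C v] by (simp add: K_simps Z.M.minus_eq Z.M.r_neg)
    qed (use module_hom_add[OF \<rho>C] module_hom_smult[OF \<rho>C] in \<open>simp_all add: K_simps\<close>)
    show "\<rho> v = y \<odot>\<^bsub>K\<^esub> v" if "v \<in> carrier K" for v
      using that y by (simp add: \<rho>_def K_simps C.M.minus_eq)
    show "\<rho> (\<sigma> z) = \<zero>\<^bsub>K\<^esub>" if "z \<in> carrier Z" for z
      using that y by (simp add: \<rho>_def sec module_hom_smult[OF \<sigma>] K_simps C.M.minus_eq C.M.r_neg)
    show "\<rho> v \<oplus>\<^bsub>?C\<^esub> \<sigma> (\<pi> v) = y \<odot>\<^bsub>?C\<^esub> v" if "v \<in> carrier ?C" for v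
      using that y by (simp add: \<rho>_def C.M.minus_eq C.M.a_assoc C.M.l_neg)
  qed
qed

text \<open>This is Schanuel's trick. Up to scalars \<open>R\<^sup>c\<close> is \<open>K \<oplus> Z\<close> and \<open>R\<^sup>a\<close> is \<open>Z \<oplus> R\<^sup>b\<close>, so both \<open>K \<oplus> R\<^sup>a\<close> and
  \<open>R\<^sup>c \<oplus> R\<^sup>b\<close> are \<open>K \<oplus> Z \<oplus> R\<^sup>b\<close>. The maps \<open>\<gamma>1\<close>, \<open>\<gamma>2\<close>, \<open>\<delta>1\<close>, \<open>\<delta>2\<close> in the proof are this identification with the
  scalars put in so that all compositions become multiplication by the same element.\<close>

lemma stably_free_up_to_kernel:
  fixes R (structure)
  assumes "module R Z"
    and \<pi>: "\<pi> \<in> module_hom R (free_module R c) Z"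
    and \<sigma>: "\<sigma> \<in> module_hom R Z (free_module R c)"
    and y: "y \<in> carrier R" and s: "s \<in> carrier R"
    and sec: "\<And>z. z \<in> carrier Z \<Longrightarrow> \<pi> (\<sigma> z) = y \<odot>\<^bsub>Z\<^esub> z"
    and free: "stably_free_up_to R s Z a b"
  defines "K \<equiv> (free_module R c)\<lparr>carrier := module_ker (free_module R c) Z \<pi>\<rparr>"
  shows "stably_free_up_to R (s \<otimes> y) K (c + b) a"
proof -
  interpret Z: module R Z by fact
  let ?C = "free_module R c" and ?A = "free_module R a" and ?B = "free_module R b"
    and ?CB = "free_module R (c + b)"
  interpret C: module R ?C by (rule Z.free_module_module)
  interpret A: module R ?A by (rule Z.free_module_module)
  interpret B: module R ?B by (rule Z.free_module_module)
  interpret CB: module R ?CB by (rule Z.free_module_module)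
  interpret K: module R K unfolding K_def
    by (rule module_ker_module[OF C.module_axioms Z.module_axioms \<pi>])
  note [simp del] = free_module_simps
  obtain \<alpha>1 \<alpha>2 \<beta>1 \<beta>2 where
    \<alpha>1: "\<alpha>1 \<in> module_hom R Z ?A" and \<alpha>2: "\<alpha>2 \<in> module_hom R ?B ?A" and
    \<beta>1: "\<beta>1 \<in> module_hom R ?A Z" and \<beta>2: "\<beta>2 \<in> module_hom R ?A ?B" and
    b1a1: "\<And>z. z \<in> carrier Z \<Longrightarrow> \<beta>1 (\<alpha>1 z) = s \<odot>\<^bsub>Z\<^esub> z" and
    b2a1: "\<And>z. z \<in> carrier Z \<Longrightarrow> \<beta>2 (\<alpha>1 z) = \<zero>\<^bsub>?B\<^esub>" and
    b1a2: "\<And>w. w \<in> carrier ?B \<Longrightarrow> \<beta>1 (\<alpha>2 w) = \<zero>\<^bsub>Z\<^esub>" and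
    b2a2: "\<And>w. w \<in> carrier ?B \<Longrightarrow> \<beta>2 (\<alpha>2 w) = s \<odot>\<^bsub>?B\<^esub> w" and
    ab: "\<And>u. u \<in> carrier ?A \<Longrightarrow> \<alpha>1 (\<beta>1 u) \<oplus>\<^bsub>?A\<^esub> \<alpha>2 (\<beta>2 u) = s \<odot>\<^bsub>?A\<^esub> u"
    using free unfolding stably_free_up_to_def by blast
  note closed [simp] = module_hom_closed[OF \<alpha>1] module_hom_closed[OF \<alpha>2] module_hom_closed[OF \<beta>1]
    module_hom_closed[OF \<beta>2] module_hom_closed[OF \<pi>] module_hom_closed[OF \<sigma>]
  note zeros [simp] = module_hom_zero[OF Z.module_axioms A.module_axioms \<alpha>1]
    module_hom_zero[OF B.module_axioms A.module_axioms \<alpha>2]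
    module_hom_zero[OF A.module_axioms Z.module_axioms \<beta>1]
    module_hom_zero[OF A.module_axioms B.module_axioms \<beta>2]
    module_hom_zero[OF C.module_axioms Z.module_axioms \<pi>]
    module_hom_zero[OF Z.module_axioms C.module_axioms \<sigma>]
  note adds = module_hom_add[OF \<alpha>1] module_hom_add[OF \<alpha>2] module_hom_add[OF \<beta>1]
    module_hom_add[OF \<beta>2] module_hom_add[OF \<pi>] module_hom_add[OF \<sigma>]
  note smults = module_hom_smult[OF \<alpha>1] module_hom_smult[OF \<alpha>2] module_hom_smult[OF \<beta>1]
    module_hom_smult[OF \<beta>2] module_hom_smult[OF \<pi>] module_hom_smult[OF \<sigma>]
  note K_simps = kernel_module_simps[where R = R and Z = Z and c = c and \<pi> = \<pi>, folded K_def]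
  obtain \<rho> where \<rho>: "\<rho> \<in> module_hom R ?C K"
    and \<rho>K: "\<And>v. v \<in> carrier K \<Longrightarrow> \<rho> v = y \<odot>\<^bsub>K\<^esub> v"
    and \<rho>\<sigma>: "\<And>z. z \<in> carrier Z \<Longrightarrow> \<rho> (\<sigma> z) = \<zero>\<^bsub>K\<^esub>"
    and \<rho>\<pi>: "\<And>v. v \<in> carrier ?C \<Longrightarrow> \<rho> v \<oplus>\<^bsub>?C\<^esub> \<sigma> (\<pi> v) = y \<odot>\<^bsub>?C\<^esub> v"
    using projection_along_section[OF assms(1) \<pi> \<sigma> y sec] unfolding K_def by metis
  have K_incl: "(\<lambda>v. v) \<in> module_hom R K ?C"
    by (rule module_homI) (simp_all add: K_simps)
  let ?top = "\<lambda>v. restrict v {..<c}" and ?bot = "vdrop c b"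
  have top: "?top \<in> module_hom R ?CB ?C" by (rule restrict_hom) simp
  have bot: "?bot \<in> module_hom R ?CB ?B" by (rule vdrop_hom)
  note [simp] = module_hom_closed[OF top] module_hom_closed[OF bot]
  define \<gamma>1 where "\<gamma>1 v = vappend c b (s \<odot>\<^bsub>?C\<^esub> v) \<zero>\<^bsub>?B\<^esub>" for v
  define \<gamma>2 where "\<gamma>2 u = vappend c b (\<sigma> (\<beta>1 u)) (y \<odot>\<^bsub>?B\<^esub> \<beta>2 u)" for u
  define \<delta>1 where "\<delta>1 x = \<rho> (?top x)" for x
  define \<delta>2 where "\<delta>2 x = \<alpha>1 (\<pi> (?top x)) \<oplus>\<^bsub>?A\<^esub> \<alpha>2 (?bot x)" for x
  have "\<gamma>1 \<in> module_hom R K ?CB"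
    unfolding \<gamma>1_def
    by (intro vappend_hom module_hom_scale K_incl module_hom_const_zero C.module_axioms B.module_axioms s)
  moreover have "\<gamma>2 \<in> module_hom R ?A ?CB"
    unfolding \<gamma>2_def
    by (intro vappend_hom module_hom_scale module_hom_comp[OF \<beta>1 \<sigma>] \<beta>2 B.module_axioms y)
  moreover have "\<delta>1 \<in> module_hom R ?CB K"
    unfolding \<delta>1_def by (rule module_hom_comp[OF top \<rho>])
  moreover have "\<delta>2 \<in> module_hom R ?CB ?A"
    unfolding \<delta>2_def
    by (intro module_hom_plus module_hom_comp[OF module_hom_comp[OF top \<pi>] \<alpha>1] module_hom_comp[OF bot \<alpha>2]
        A.module_axioms)
  moreover have "\<delta>1 (\<gamma>1 v) = (s \<otimes> y) \<odot>\<^bsub>K\<^esub> v" "\<delta>2 (\<gamma>1 v) = \<zero>\<^bsub>?A\<^esub>" if "v \<in> carrier K" for v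
  proof -
    have v: "v \<in> carrier ?C" "\<pi> v = \<zero>\<^bsub>Z\<^esub>" using that by (auto simp: K_simps)
    show "\<delta>1 (\<gamma>1 v) = (s \<otimes> y) \<odot>\<^bsub>K\<^esub> v"
      using v s y that module_hom_smult[OF \<rho> s v(1)]
      by (simp add: \<delta>1_def \<gamma>1_def restrict_vappend[of _ R] module_hom_smult[OF \<rho>] \<rho>K C.smult_assoc1 K_simps)
    show "\<delta>2 (\<gamma>1 v) = \<zero>\<^bsub>?A\<^esub>"
      using v s by (simp add: \<delta>2_def \<gamma>1_def restrict_vappend[of _ R] vdrop_vappend[of _ R] smults)
  qed
  moreover have "\<delta>1 (\<gamma>2 u) = \<zero>\<^bsub>K\<^esub>" "\<delta>2 (\<gamma>2 u) = (s \<otimes> y) \<odot>\<^bsub>?A\<^esub> u" if u: "u \<in> carrier ?A" for u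
  proof -
    show "\<delta>1 (\<gamma>2 u) = \<zero>\<^bsub>K\<^esub>"
      using u by (simp add: \<delta>1_def \<gamma>2_def restrict_vappend[of _ R] \<rho>\<sigma>)
    have "\<delta>2 (\<gamma>2 u) = y \<odot>\<^bsub>?A\<^esub> (\<alpha>1 (\<beta>1 u) \<oplus>\<^bsub>?A\<^esub> \<alpha>2 (\<beta>2 u))"
      using u y by (simp add: \<delta>2_def \<gamma>2_def restrict_vappend[of _ R] vdrop_vappend[of _ R] sec smults A.smult_r_distr)
    then show "\<delta>2 (\<gamma>2 u) = (s \<otimes> y) \<odot>\<^bsub>?A\<^esub> u"
      using u y s by (simp add: ab Z.R.m_comm flip: A.smult_assoc1)
  qed
  moreover have "\<gamma>1 (\<delta>1 x) \<oplus>\<^bsub>?CB\<^esub> \<gamma>2 (\<delta>2 x) = (s \<otimes> y) \<odot>\<^bsub>?CB\<^esub> x" if x: "x \<in> carrier ?CB" for x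
  proof -
    define v where "v = ?top x"
    define w where "w = ?bot x"
    have vw: "v \<in> carrier ?C" "w \<in> carrier ?B" using x by (simp_all add: v_def w_def)
    have "\<beta>1 (\<delta>2 x) = s \<odot>\<^bsub>Z\<^esub> \<pi> v" "\<beta>2 (\<delta>2 x) = s \<odot>\<^bsub>?B\<^esub> w"
      using vw s by (simp_all add: \<delta>2_def adds b1a1 b1a2 b2a1 b2a2 flip: v_def w_def)
    then have "\<gamma>1 (\<delta>1 x) \<oplus>\<^bsub>?CB\<^esub> \<gamma>2 (\<delta>2 x) =
        vappend c b (s \<odot>\<^bsub>?C\<^esub> \<rho> v \<oplus>\<^bsub>?C\<^esub> s \<odot>\<^bsub>?C\<^esub> \<sigma> (\<pi> v)) (\<zero>\<^bsub>?B\<^esub> \<oplus>\<^bsub>?B\<^esub> y \<odot>\<^bsub>?B\<^esub> (s \<odot>\<^bsub>?B\<^esub> w))"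
      using vw s by (simp add: \<gamma>1_def \<gamma>2_def \<delta>1_def vappend_add smults flip: v_def w_def)
    also have "s \<odot>\<^bsub>?C\<^esub> \<rho> v \<oplus>\<^bsub>?C\<^esub> s \<odot>\<^bsub>?C\<^esub> \<sigma> (\<pi> v) = (s \<otimes> y) \<odot>\<^bsub>?C\<^esub> v"
      using vw s y \<rho>\<pi>[of v] module_hom_closed[OF \<rho> vw(1)]
      by (simp add: C.smult_assoc1 K_simps flip: C.smult_r_distr)
    also have "\<zero>\<^bsub>?B\<^esub> \<oplus>\<^bsub>?B\<^esub> y \<odot>\<^bsub>?B\<^esub> (s \<odot>\<^bsub>?B\<^esub> w) = (s \<otimes> y) \<odot>\<^bsub>?B\<^esub> w"
      using vw s y by (simp add: Z.R.m_comm flip: B.smult_assoc1)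
    also have "vappend c b ((s \<otimes> y) \<odot>\<^bsub>?C\<^esub> v) ((s \<otimes> y) \<odot>\<^bsub>?B\<^esub> w) = (s \<otimes> y) \<odot>\<^bsub>?CB\<^esub> x"
      using vappend_restrict_vdrop[OF x] by (simp add: vappend_smult v_def w_def)
    finally show ?thesis .
  qed
  ultimately show ?thesis unfolding stably_free_up_to_def by blast
qed

text \<open>A section up to \<open>y\<close> propagates along a free resolution: the projection of \<open>R\<^sup>c\<close> onto \<open>K\<close> lifts to \<open>R\<^sup>d\<close>
  because \<open>R\<^sup>c\<close> is free, and on \<open>K\<close> this projection is multiplication by \<open>y\<close>. Iterating this builds a
  homotopy between multiplication by \<open>y\<close> on the resolution and \<open>0\<close>.\<close>

lemma section_of_kernel:
  fixes R (structure)
  assumes "module R Z"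
    and \<pi>: "\<pi> \<in> module_hom R (free_module R c) Z"
    and \<sigma>: "\<sigma> \<in> module_hom R Z (free_module R c)"
    and y: "y \<in> carrier R"
    and sec: "\<And>z. z \<in> carrier Z \<Longrightarrow> \<pi> (\<sigma> z) = y \<odot>\<^bsub>Z\<^esub> z"
  defines "K \<equiv> (free_module R c)\<lparr>carrier := module_ker (free_module R c) Z \<pi>\<rparr>"
  assumes f: "f \<in> module_hom R (free_module R d) K" "carrier K \<subseteq> f ` carrier (free_module R d)"
  obtains \<tau> where "\<tau> \<in> module_hom R K (free_module R d)"
    and "\<And>v. v \<in> carrier K \<Longrightarrow> f (\<tau> v) = y \<odot>\<^bsub>K\<^esub> v"
proof -
  interpret Z: module R Z by fact
  let ?C = "free_module R c" and ?D = "free_module R d"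
  interpret C: module R ?C by (rule Z.free_module_module)
  interpret D: module R ?D by (rule Z.free_module_module)
  interpret K: module R K unfolding K_def
    by (rule module_ker_module[OF C.module_axioms Z.module_axioms \<pi>])
  note [simp del] = free_module_simps
  note K_simps = kernel_module_simps[where R = R and Z = Z and c = c and \<pi> = \<pi>, folded K_def]
  obtain \<rho> where \<rho>: "\<rho> \<in> module_hom R ?C K"
    and \<rho>K: "\<And>v. v \<in> carrier K \<Longrightarrow> \<rho> v = y \<odot>\<^bsub>K\<^esub> v"
    and \<rho>\<sigma>: "\<And>z. z \<in> carrier Z \<Longrightarrow> \<rho> (\<sigma> z) = \<zero>\<^bsub>K\<^esub>"
    and \<rho>\<pi>: "\<And>v. v \<in> carrier ?C \<Longrightarrow> \<rho> v \<oplus>\<^bsub>?C\<^esub> \<sigma> (\<pi> v) = y \<odot>\<^bsub>?C\<^esub> v"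
    using projection_along_section[OF assms(1) \<pi> \<sigma> y sec] unfolding K_def by metis
  have K_incl: "(\<lambda>v. v) \<in> module_hom R K ?C"
    by (rule module_homI) (simp_all add: K_simps)
  have "\<rho> ` carrier ?C \<subseteq> f ` carrier ?D"
    using module_hom_closed[OF \<rho>] f(2) by blast
  from Z.free_module_lift[OF D.module_axioms K.module_axioms f(1) \<rho> this]
  obtain \<tau> where \<tau>: "\<tau> \<in> module_hom R ?C ?D" "\<And>x. x \<in> carrier ?C \<Longrightarrow> f (\<tau> x) = \<rho> x" by blast
  show ?thesis
    using module_hom_comp[OF K_incl \<tau>(1)] \<tau>(2) \<rho>K by (intro that[of \<tau>]) (auto simp: K_simps)
qed

section \<open>Ranks\<close>

text \<open>Since \<open>t\<close> kills \<open>Z\<close>, multiplication by \<open>t s\<close> on \<open>R\<^sup>a\<close> factors through \<open>R\<^sup>b\<close>. If \<open>b < a\<close>, forgetting the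
  last \<open>a - b\<close> coordinates and going back to \<open>R\<^sup>a\<close> is an endomorphism whose image contains \<open>t s R\<^sup>a\<close> but which
  kills a basis vector, so that a power of \<open>t s\<close> would be zero.\<close>

lemma stably_free_rank_le:
  fixes R (structure)
  assumes "noetherian_ring R" "module R Z" "s \<in> carrier R" "t \<in> carrier R"
    and free: "stably_free_up_to R s Z a b"
    and kill: "\<And>z. z \<in> carrier Z \<Longrightarrow> t \<odot>\<^bsub>Z\<^esub> z = \<zero>\<^bsub>Z\<^esub>"
    and nonnil: "\<And>k::nat. (t \<otimes> s) [^] k \<noteq> \<zero>"
  shows "a \<le> b"
proof (rule ccontr)
  assume "\<not> a \<le> b"
  then have ba: "b < a" "b + (a - b) = a" by auto
  interpret Z: module R Z by fact
  let ?A = "free_module R a" and ?B = "free_module R b" and ?D = "free_module R (a - b)"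
  interpret A: module R ?A by (rule Z.free_module_module)
  interpret B: module R ?B by (rule Z.free_module_module)
  interpret D: module R ?D by (rule Z.free_module_module)
  note [simp] = assms(3,4)
  obtain \<alpha>1 \<alpha>2 \<beta>1 \<beta>2 where
    \<alpha>1: "\<alpha>1 \<in> module_hom R Z ?A" and \<alpha>2: "\<alpha>2 \<in> module_hom R ?B ?A" and
    \<beta>1: "\<beta>1 \<in> module_hom R ?A Z" and \<beta>2: "\<beta>2 \<in> module_hom R ?A ?B" and
    ab: "\<And>u. u \<in> carrier ?A \<Longrightarrow> \<alpha>1 (\<beta>1 u) \<oplus>\<^bsub>?A\<^esub> \<alpha>2 (\<beta>2 u) = s \<odot>\<^bsub>?A\<^esub> u"
    using free unfolding stably_free_up_to_def by blast
  define h where "h u = t \<odot>\<^bsub>?A\<^esub> \<alpha>2 (restrict u {..<b})" for u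
  have res: "(\<lambda>u. restrict u {..<b}) \<in> module_hom R ?A ?B"
    using ba by (intro restrict_hom) simp
  have h: "h \<in> module_hom R ?A ?A"
    unfolding h_def by (intro module_hom_scale module_hom_comp[OF res \<alpha>2] A.module_axioms) simp
  have surj: "\<exists>w\<in>carrier ?A. h w = (t \<otimes> s) \<odot>\<^bsub>?A\<^esub> u" if u: "u \<in> carrier ?A" for u
  proof
    note [simp del] = free_module_simps
    note [simp] = u module_hom_closed[OF \<alpha>1] module_hom_closed[OF \<alpha>2] module_hom_closed[OF \<beta>1]
      module_hom_closed[OF \<beta>2]
    let ?w = "vappend b (a - b) (\<beta>2 u) \<zero>\<^bsub>?D\<^esub>"
    show "?w \<in> carrier ?A"
      using vappend_closed[of "\<beta>2 u" R b "\<zero>\<^bsub>?D\<^esub>" "a - b"] ba by simp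
    have "t \<odot>\<^bsub>?A\<^esub> \<alpha>1 (\<beta>1 u) = \<zero>\<^bsub>?A\<^esub>"
      using module_hom_smult[OF \<alpha>1, of t "\<beta>1 u"] kill[of "\<beta>1 u"]
        module_hom_zero[OF Z.module_axioms A.module_axioms \<alpha>1] by simp
    then have "h ?w = t \<odot>\<^bsub>?A\<^esub> (\<alpha>1 (\<beta>1 u) \<oplus>\<^bsub>?A\<^esub> \<alpha>2 (\<beta>2 u))"
      by (simp add: h_def restrict_vappend[of _ R] A.smult_r_distr)
    then show "h ?w = (t \<otimes> s) \<odot>\<^bsub>?A\<^esub> u"
      by (simp add: ab A.smult_assoc1)
  qed
  have "restrict (unit_vec R a b) {..<b} = \<zero>\<^bsub>?B\<^esub>"
    using ba by (auto simp: unit_vec_def intro!: ext)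
  then have "h (unit_vec R a b) = \<zero>\<^bsub>?A\<^esub>"
    unfolding h_def using module_hom_zero[OF B.module_axioms A.module_axioms \<alpha>2]
      A.smult_r_null[OF assms(4)] by metis
  with almost_surjective_endo_kernel[OF Z.R.cring_axioms assms(1) h _ surj Z.unit_vec_closed]
  obtain k :: nat where "((t \<otimes> s) [^] k) \<odot>\<^bsub>?A\<^esub> unit_vec R a b = \<zero>\<^bsub>?A\<^esub>"
    by auto
  from fun_cong[OF this, of b] have "(t \<otimes> s) [^] k = \<zero>"
    using ba by (simp add: unit_vec_def)
  with nonnil show False by blast
qed

text \<open>Up to \<open>s\<close>, \<open>\<beta>\<^sub>2\<close> maps \<open>R\<^sup>a\<close> onto \<open>R\<^sup>b\<close> with kernel \<open>Z\<close>. When \<open>a \<le> b\<close>, precomposing \<open>\<beta>\<^sub>2\<close> with the truncation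
  \<open>R\<^sup>b \<rightarrow> R\<^sup>a\<close> gives an almost surjective endomorphism of \<open>R\<^sup>b\<close>, whose kernel contains \<open>Z\<close> padded by zeros.\<close>

lemma stably_free_torsion:
  fixes R (structure)
  assumes "noetherian_ring R" "module R Z" "s \<in> carrier R"
    and free: "stably_free_up_to R s Z a b" and ab: "a \<le> b"
    and z: "z \<in> carrier Z"
  shows "\<exists>k::nat. (s [^] k) \<odot>\<^bsub>Z\<^esub> z = \<zero>\<^bsub>Z\<^esub>"
proof -
  have ba: "a + (b - a) = b" using ab by auto
  interpret Z: module R Z by fact
  let ?A = "free_module R a" and ?B = "free_module R b" and ?D = "free_module R (b - a)"
  interpret A: module R ?A by (rule Z.free_module_module)
  interpret B: module R ?B by (rule Z.free_module_module)
  interpret D: module R ?D by (rule Z.free_module_module)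
  note [simp] = assms(3)
  note [simp del] = free_module_simps
  obtain \<alpha>1 \<alpha>2 \<beta>1 \<beta>2 where
    \<alpha>1: "\<alpha>1 \<in> module_hom R Z ?A" and \<alpha>2: "\<alpha>2 \<in> module_hom R ?B ?A" and
    \<beta>1: "\<beta>1 \<in> module_hom R ?A Z" and \<beta>2: "\<beta>2 \<in> module_hom R ?A ?B" and
    b1a1: "\<And>z. z \<in> carrier Z \<Longrightarrow> \<beta>1 (\<alpha>1 z) = s \<odot>\<^bsub>Z\<^esub> z" and
    b2a1: "\<And>z. z \<in> carrier Z \<Longrightarrow> \<beta>2 (\<alpha>1 z) = \<zero>\<^bsub>?B\<^esub>" and
    b2a2: "\<And>w. w \<in> carrier ?B \<Longrightarrow> \<beta>2 (\<alpha>2 w) = s \<odot>\<^bsub>?B\<^esub> w"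
    using free unfolding stably_free_up_to_def by blast
  let ?pad = "\<lambda>u. vappend a (b - a) u \<zero>\<^bsub>?D\<^esub>"
  have pad: "?pad u \<in> carrier ?B" if "u \<in> carrier ?A" for u
    using vappend_closed[OF that D.M.zero_closed] ba by simp
  have res: "(\<lambda>u. restrict u {..<a}) \<in> module_hom R ?B ?A"
    by (intro restrict_hom ab)
  define h where "h u = \<beta>2 (restrict u {..<a})" for u
  have h: "h \<in> module_hom R ?B ?B"
    unfolding h_def by (rule module_hom_comp[OF res \<beta>2])
  have hp: "h (?pad u) = \<beta>2 u" if "u \<in> carrier ?A" for u
    using that by (simp add: h_def restrict_vappend[of _ R])
  have surj: "\<exists>w\<in>carrier ?B. h w = s \<odot>\<^bsub>?B\<^esub> u" if "u \<in> carrier ?B" for u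
    using module_hom_closed[OF \<alpha>2 that] that by (intro bexI[of _ "?pad (\<alpha>2 u)"]) (simp_all add: hp pad b2a2)
  have z1: "\<alpha>1 z \<in> carrier ?A" by (rule module_hom_closed[OF \<alpha>1 z])
  have "h (?pad (\<alpha>1 z)) = \<zero>\<^bsub>?B\<^esub>" by (simp add: hp z1 b2a1 z)
  from almost_surjective_endo_kernel[OF Z.R.cring_axioms assms(1) h assms(3) surj pad[OF z1] this]
  obtain k :: nat where k: "(s [^] k) \<odot>\<^bsub>?B\<^esub> ?pad (\<alpha>1 z) = \<zero>\<^bsub>?B\<^esub>" by blast
  have "(s [^] k) \<odot>\<^bsub>?A\<^esub> restrict (?pad (\<alpha>1 z)) {..<a} = restrict \<zero>\<^bsub>?B\<^esub> {..<a}"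
    using module_hom_smult[OF res _ pad[OF z1], of "s [^] k"] k by simp
  then have "(s [^] k) \<odot>\<^bsub>?A\<^esub> \<alpha>1 z = \<zero>\<^bsub>?A\<^esub>"
    using module_hom_zero[OF B.module_axioms A.module_axioms res] z1 by (simp add: restrict_vappend[of _ R])
  then have "(s [^] k) \<odot>\<^bsub>Z\<^esub> (s \<odot>\<^bsub>Z\<^esub> z) = \<zero>\<^bsub>Z\<^esub>"
    using module_hom_smult[OF \<beta>1 _ z1, of "s [^] k"] module_hom_zero[OF A.module_axioms Z.module_axioms \<beta>1]
    by (simp add: b1a1 z)
  then have "(s [^] Suc k) \<odot>\<^bsub>Z\<^esub> z = \<zero>\<^bsub>Z\<^esub>"
    using z by (simp add: Z.smult_assoc1)
  then show ?thesis by blast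
qed

section \<open>Local rings\<close>

lemma nonunit_in_maximalideal:
  fixes R (structure)
  assumes "cring R" "noetherian_ring R" "a \<in> carrier R" "a \<notin> Units R"
  obtains m where "maximalideal m R" "a \<in> m"
proof -
  interpret cring R by fact
  interpret noetherian_ring R by fact
  let ?S = "{I. ideal I R \<and> a \<in> I \<and> \<one> \<notin> I}"
  have "\<one> \<notin> PIdl a"
    using assms(3,4) by (auto simp: cgenideal_def Units_def m_comm)
  then have "PIdl a \<in> ?S"
    using cgenideal_ideal[OF assms(3)] cgenideal_self[OF assms(3)] by blast
  then have "\<exists>I\<in>?S. \<forall>J\<in>?S. I \<subseteq> J \<longrightarrow> J = I"
    by (intro exists_maximal_ideal_in) auto
  then obtain I where I: "I \<in> ?S" "\<forall>J\<in>?S. I \<subseteq> J \<longrightarrow> J = I" ..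
  have "maximalideal I R"
  proof (rule maximalidealI)
    show "ideal I R" "carrier R \<noteq> I" using I(1) by auto
    fix J assume J: "ideal J R" "I \<subseteq> J" "J \<subseteq> carrier R"
    show "J = I \<or> J = carrier R"
      using I J ideal.one_imp_carrier[OF J(1)] by blast
  qed
  then show ?thesis using I(1) that by blast
qed

text \<open>Among the annihilators of the nonzero multiples of \<open>r\<close> choose a maximal one, \<open>P = ann x\<close>. For \<open>y \<in> m\<close>
  let \<open>y\<^sup>j x\<close> be the last nonzero member of \<open>x, y x, y\<^sup>2 x, \<dots>\<close>; its annihilator contains both \<open>P\<close> and \<open>y\<close>,
  and equals \<open>P\<close> by maximality. Hence \<open>m \<subseteq> P\<close>, and \<open>P\<close> is proper.\<close>

lemma torsion_maximalideal_in_Ass: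
  fixes R (structure)
  assumes "cring R" "noetherian_ring R" "maximalideal m R"
    and r: "r \<in> carrier R" "r \<noteq> \<zero>"
    and tors: "\<And>y. y \<in> m \<Longrightarrow> \<exists>k::nat. (y [^] k) \<otimes> r = \<zero>"
  shows "m \<in> Ass R (regular_module R)"
proof -
  interpret cring R by fact
  interpret noetherian_ring R by fact
  interpret m: maximalideal m R by fact
  define ann where "ann x = {a \<in> carrier R. a \<otimes> x = \<zero>}" for x
  have ann_ideal: "ideal (ann x) R" if x: "x \<in> carrier R" for x
  proof (rule idealI)
    show "subgroup (ann x) (add_monoid R)"
      using x by (intro add.subgroupI) (auto simp: ann_def l_distr l_minus)
    show "b \<otimes> a \<in> ann x" "a \<otimes> b \<in> ann x" if "a \<in> ann x" "b \<in> carrier R" for a b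
      using that x by (auto simp: ann_def m_assoc) (metis m_assoc m_comm r_null)
  qed (rule ring_axioms)
  define \<A> where "\<A> = {ann (c \<otimes> r) | c. c \<in> carrier R \<and> c \<otimes> r \<noteq> \<zero>}"
  have "\<A> \<noteq> {}"
    using r by (auto simp: \<A>_def intro!: exI[of _ \<one>])
  moreover have "ideal I R" if "I \<in> \<A>" for I
    using that ann_ideal r by (auto simp: \<A>_def)
  ultimately have "\<exists>P\<in>\<A>. \<forall>J\<in>\<A>. P \<subseteq> J \<longrightarrow> J = P"
    by (rule exists_maximal_ideal_in)
  then obtain P where P: "P \<in> \<A>" "\<forall>J\<in>\<A>. P \<subseteq> J \<longrightarrow> J = P" ..
  from P(1) obtain c where c: "c \<in> carrier R" "c \<otimes> r \<noteq> \<zero>" "P = ann (c \<otimes> r)"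
    by (auto simp: \<A>_def)
  let ?x = "c \<otimes> r"
  have "m \<subseteq> P"
  proof
    fix y assume y: "y \<in> m"
    then have yR: "y \<in> carrier R" using m.a_subset by blast
    obtain k :: nat where "(y [^] k) \<otimes> r = \<zero>" using tors[OF y] by blast
    then have "(y [^] k) \<otimes> ?x = \<zero>"
      using yR c(1) r(1) by (metis m_lcomm nat_pow_closed r_null)
    then have ex: "\<exists>k::nat. (y [^] k) \<otimes> ?x = \<zero>" by blast
    define k where "k = (LEAST k::nat. (y [^] k) \<otimes> ?x = \<zero>)"
    have k: "(y [^] k) \<otimes> ?x = \<zero>" unfolding k_def by (rule LeastI_ex[OF ex])
    then have "k \<noteq> 0" using c r(1) by (cases k) auto
    then obtain j where j: "k = Suc j" by (cases k) auto
    have nz: "(y [^] j) \<otimes> ?x \<noteq> \<zero>"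
      using not_less_Least[of j "\<lambda>k. (y [^] k) \<otimes> ?x = \<zero>"] j by (simp add: k_def)
    have assoc: "(y [^] j) \<otimes> ?x = ((y [^] j) \<otimes> c) \<otimes> r"
      using yR c(1) r(1) by (simp add: m_assoc)
    have "ann ((y [^] j) \<otimes> ?x) \<in> \<A>"
      using nz yR c(1) unfolding assoc \<A>_def by (intro CollectI exI[of _ "(y [^] j) \<otimes> c"]) simp
    moreover have "P \<subseteq> ann ((y [^] j) \<otimes> ?x)"
    proof
      fix a assume "a \<in> P"
      then have a: "a \<in> carrier R" "a \<otimes> ?x = \<zero>" by (auto simp: c(3) ann_def)
      have "a \<otimes> ((y [^] j) \<otimes> ?x) = (y [^] j) \<otimes> (a \<otimes> ?x)"
        using a(1) yR c(1) r(1) by (intro m_lcomm) auto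
      then show "a \<in> ann ((y [^] j) \<otimes> ?x)"
        using a yR by (simp add: ann_def)
    qed
    ultimately have "ann ((y [^] j) \<otimes> ?x) = P" using P(2) by blast
    moreover have "y \<in> ann ((y [^] j) \<otimes> ?x)"
      using k yR c(1) r(1) by (simp add: ann_def j m_assoc m_lcomm[of y "y [^] j"])
    ultimately show "y \<in> P" by simp
  qed
  moreover have "\<one> \<notin> P" using c r(1) by (auto simp: ann_def)
  moreover have "ideal P R" using ann_ideal[of ?x] c r(1) by simp
  ultimately have mP: "m = P"
    using m.I_maximal[of P] ideal.Icarr[of P R] by auto
  have "annihilator R (regular_module R) x = ann x" for x
    by (simp add: ann_def annihilator_def regular_module_def)
  then have "m = annihilator R (regular_module R) ?x"
    by (simp only: mP c(3))
  moreover have "?x \<in> carrier (regular_module R)"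
    using c(1) r(1) by (simp add: regular_module_def)
  ultimately show ?thesis
    unfolding Ass_def Spec_def using maximalideal_prime[OF assms(3)] by blast
qed

lemma krull_dim_quot_maximalideal:
  fixes R (structure)
  assumes "cring R" "maximalideal m R"
  shows "krull_dim (R Quot m) = 0"
proof -
  interpret F: field "R Quot m" by (rule maximalideal.quotient_is_field[OF assms(2,1)])
  have sub: "p = {\<zero>\<^bsub>R Quot m\<^esub>}" if "p \<in> Spec (R Quot m)" for p
  proof -
    have p: "primeideal p (R Quot m)" using that by (simp add: Spec_def)
    have "p \<in> {I. ideal I (R Quot m)}" using primeideal.axioms(1)[OF p] by simp
    then have "p = {\<zero>\<^bsub>R Quot m\<^esub>} \<or> p = carrier (R Quot m)"
      unfolding F.all_ideals by simp
    then show ?thesis using primeideal.I_notcarr[OF p] by metis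
  qed
  have "n = 0" if "\<forall>i\<le>n. c i \<in> Spec (R Quot m)" "\<forall>i<n. c i \<subset> c (Suc i)" for n c
  proof (rule ccontr)
    assume "n \<noteq> 0"
    then have "c 0 \<subset> c (Suc 0)" "c 0 \<in> Spec (R Quot m)" "c (Suc 0) \<in> Spec (R Quot m)"
      using that by auto
    then show False using sub[of "c 0"] sub[of "c (Suc 0)"] by simp
  qed
  then have "krull_dim (R Quot m) \<le> 0"
    unfolding krull_dim_def chain_height_def by (intro Sup_least) (auto simp: zero_enat_def)
  then show ?thesis by simp
qed

text \<open>With \<open>L\<close> the length of \<open>M\<close>, the chain \<open>R x\<^bsup>L+1\<^esup> v \<subseteq> R x\<^sup>L v \<subseteq> \<dots> \<subseteq> R v\<close> cannot be strict everywhere. An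
  equality \<open>R x\<^bsup>k+1\<^esup> v = R x\<^sup>k v\<close> gives \<open>(1 - a x) x\<^sup>k v = 0\<close> for some \<open>a\<close>, where \<open>1 - a x\<close> is a unit. As \<open>k \<le> L\<close>,
  the exponent \<open>L\<close> works for all \<open>v\<close> at once.\<close>

lemma finite_length_power_kills:
  fixes R (structure)
  assumes "noetherian_ring R" "local_ring R" "module R M" "module_length R M < \<infinity>"
    and m: "maximalideal m R" and x: "x \<in> m"
  shows "\<exists>N::nat. \<forall>v\<in>carrier M. (x [^] N) \<odot>\<^bsub>M\<^esub> v = \<zero>\<^bsub>M\<^esub>"
proof -
  interpret M: module R M by fact
  interpret m: maximalideal m R by fact
  have xR [simp]: "x \<in> carrier R" by (rule subsetD[OF m.a_subset x])
  obtain L where L: "module_length R M = enat L"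
    using less_imp_neq[OF assms(4)] unfolding not_infinity_eq by blast
  have bound: "n \<le> L" if "\<forall>i\<le>n. submodule (c i) R M" "\<forall>i<n. c i \<subset> c (Suc i)" for n c
  proof -
    have "enat n \<le> module_length R M"
      unfolding module_length_def chain_height_def using that by (intro Sup_upper) auto
    then show ?thesis using L by simp
  qed
  have unit: "\<one> \<ominus> a \<otimes> x \<in> Units R" if a: "a \<in> carrier R" for a
  proof (rule ccontr)
    assume "\<one> \<ominus> a \<otimes> x \<notin> Units R"
    then obtain m' where m': "maximalideal m' R" "\<one> \<ominus> a \<otimes> x \<in> m'"
      using nonunit_in_maximalideal[OF M.R.cring_axioms assms(1)] a by (metis M.R.m_closed M.R.minus_closed M.R.one_closed xR)
    then have "m' = m" using assms(2) m unfolding local_ring_def by blast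
    then have "(\<one> \<ominus> a \<otimes> x) \<oplus> a \<otimes> x \<in> m"
      using m'(2) m.a_closed m.I_l_closed[OF x a] by blast
    moreover have "(\<one> \<ominus> a \<otimes> x) \<oplus> a \<otimes> x = \<one>"
      using a by (simp add: M.R.minus_eq M.R.a_assoc M.R.l_neg)
    ultimately show False using m.one_imp_carrier m.I_notcarr by auto
  qed
  have "(x [^] L) \<odot>\<^bsub>M\<^esub> v = \<zero>\<^bsub>M\<^esub>" if v: "v \<in> carrier M" for v
  proof -
    define c where "c i = (\<lambda>a. a \<odot>\<^bsub>M\<^esub> ((x [^] (Suc L - i)) \<odot>\<^bsub>M\<^esub> v)) ` carrier R" for i
    have sub: "submodule ((\<lambda>a. a \<odot>\<^bsub>M\<^esub> w) ` carrier R) R M" if w: "w \<in> carrier M" for w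
    proof (rule M.submoduleI)
      show "\<zero>\<^bsub>M\<^esub> \<in> (\<lambda>a. a \<odot>\<^bsub>M\<^esub> w) ` carrier R"
        using w by (intro image_eqI[of _ _ "\<zero>"]) auto
    next
      fix u assume "u \<in> (\<lambda>a. a \<odot>\<^bsub>M\<^esub> w) ` carrier R"
      then show "\<ominus>\<^bsub>M\<^esub> u \<in> (\<lambda>a. a \<odot>\<^bsub>M\<^esub> w) ` carrier R"
        using w M.smult_l_minus by (auto intro!: image_eqI[of _ _ "\<ominus> _"])
    next
      fix u u' assume "u \<in> (\<lambda>a. a \<odot>\<^bsub>M\<^esub> w) ` carrier R" "u' \<in> (\<lambda>a. a \<odot>\<^bsub>M\<^esub> w) ` carrier R"
      then show "u \<oplus>\<^bsub>M\<^esub> u' \<in> (\<lambda>a. a \<odot>\<^bsub>M\<^esub> w) ` carrier R"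
        using w by (auto simp flip: M.smult_l_distr)
    next
      fix a u assume "a \<in> carrier R" "u \<in> (\<lambda>a. a \<odot>\<^bsub>M\<^esub> w) ` carrier R"
      then show "a \<odot>\<^bsub>M\<^esub> u \<in> (\<lambda>a. a \<odot>\<^bsub>M\<^esub> w) ` carrier R"
        using w by (auto simp flip: M.smult_assoc1)
    qed (use w in auto)
    have "\<forall>i\<le>Suc L. submodule (c i) R M"
      unfolding c_def using sub v by simp
    from bound[OF this] have "\<not> (\<forall>i<Suc L. c i \<subset> c (Suc i))"
      by fastforce
    then obtain i where i: "i < Suc L" "\<not> c i \<subset> c (Suc i)" by blast
    define k where "k = L - i"
    have k: "Suc L - i = Suc k" "Suc L - Suc i = k" "k \<le> L" using i by (auto simp: k_def)
    (* A failure of strictness at i compares the multiples of x^(k+1) v with those of x^k v. *)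
    have shift: "a \<odot>\<^bsub>M\<^esub> ((x [^] Suc k) \<odot>\<^bsub>M\<^esub> v) = (a \<otimes> x) \<odot>\<^bsub>M\<^esub> ((x [^] k) \<odot>\<^bsub>M\<^esub> v)"
      if "a \<in> carrier R" for a
      unfolding M.R.nat_pow_Suc2[OF xR] using that v by (simp add: M.smult_assoc1)
    have "c i \<subseteq> c (Suc i)"
    proof
      fix u assume "u \<in> c i"
      then obtain a where a: "a \<in> carrier R" "u = a \<odot>\<^bsub>M\<^esub> ((x [^] Suc k) \<odot>\<^bsub>M\<^esub> v)"
        unfolding c_def k(1) by blast
      show "u \<in> c (Suc i)"
        unfolding c_def k(2) a(2) shift[OF a(1)] using a(1) by (intro imageI) simp
    qed
    with i(2) have eq: "c i = c (Suc i)" by blast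
    let ?w = "(x [^] k) \<odot>\<^bsub>M\<^esub> v"
    have w: "?w \<in> carrier M" using v by simp
    then have "?w \<in> c i"
      unfolding eq unfolding c_def k(2) by (intro image_eqI[of _ _ \<one>]) simp_all
    then obtain a where a: "a \<in> carrier R" "?w = a \<odot>\<^bsub>M\<^esub> ((x [^] Suc k) \<odot>\<^bsub>M\<^esub> v)"
      unfolding c_def k(1) by blast
    have aw: "?w = (a \<otimes> x) \<odot>\<^bsub>M\<^esub> ?w"
      unfolding shift[OF a(1), symmetric] by (rule a(2))
    let ?u = "\<one> \<ominus> a \<otimes> x"
    have u: "?u \<in> Units R" by (rule unit[OF a(1)])
    have "?w = (inv ?u \<otimes> ?u) \<odot>\<^bsub>M\<^esub> ?w" using w u by simp
    also have "\<dots> = inv ?u \<odot>\<^bsub>M\<^esub> (?u \<odot>\<^bsub>M\<^esub> ?w)"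
      using w u by (intro M.smult_assoc1) auto
    also have "?u \<odot>\<^bsub>M\<^esub> ?w = \<zero>\<^bsub>M\<^esub>"
      using w a(1) by (simp add: M.R.minus_eq M.smult_l_distr M.smult_l_minus M.M.r_neg flip: aw)
    finally have w0: "?w = \<zero>\<^bsub>M\<^esub>" using u by simp
    have "(x [^] L) \<odot>\<^bsub>M\<^esub> v = (x [^] (L - k)) \<odot>\<^bsub>M\<^esub> ?w"
      using v k(3) by (simp add: M.R.nat_pow_mult flip: M.smult_assoc1)
    then show ?thesis by (simp add: w0)
  qed
  then show ?thesis by blast
qed

section \<open>Support\<close>

lemma primeideal_pow:
  fixes R (structure)
  assumes "primeideal p R" "t \<in> carrier R" "t \<notin> p"
  shows "t [^] (k::nat) \<notin> p"
proof -
  interpret p: primeideal p R by fact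
  show ?thesis
  proof (induction k)
    case 0
    show ?case using p.one_imp_carrier p.I_notcarr by auto
  next
    case (Suc k)
    then show ?case using p.I_prime[of "t [^] k" t] assms(2,3) by auto
  qed
qed

text \<open>Each element of \<open>Z\<close> vanishes in the localization and so is killed by some element outside \<open>p\<close>. Finitely
  many generators have a common such element, namely the product.\<close>

lemma not_in_Supp_annihilator:
  fixes R (structure)
  assumes "module R Z" "g \<in> module_hom R (free_module R d) Z" "carrier Z = g ` carrier (free_module R d)"
    and p: "p \<in> Spec R" "p \<notin> Supp R Z"
  shows "\<exists>t \<in> carrier R - p. \<forall>z\<in>carrier Z. t \<odot>\<^bsub>Z\<^esub> z = \<zero>\<^bsub>Z\<^esub>"
proof -
  interpret Z: module R Z by fact
  interpret p: primeideal p R using p(1) by (simp add: Spec_def)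
  let ?S = "carrier R - p" and ?F = "free_module R d"
  have one: "\<one> \<in> ?S" using p.one_imp_carrier p.I_notcarr by auto
  have mult: "u \<otimes> t \<in> ?S" if "u \<in> ?S" "t \<in> ?S" for u t
    using that p.I_prime[of u t] by auto
  have elt: "\<exists>u\<in>?S. u \<odot>\<^bsub>Z\<^esub> z = \<zero>\<^bsub>Z\<^esub>" if z: "z \<in> carrier Z" for z
  proof -
    let ?r = "fraction_rel R ?S Z"
    have "?r `` {(z, \<one>)} \<in> (carrier Z \<times> ?S) // ?r"
      using z one by (intro quotientI) auto
    then have "?r `` {(z, \<one>)} = ?r `` {(\<zero>\<^bsub>Z\<^esub>, \<one>)}"
      using p unfolding Supp_def Let_def localized_module_def by auto
    moreover have "((\<zero>\<^bsub>Z\<^esub>, \<one>), (\<zero>\<^bsub>Z\<^esub>, \<one>)) \<in> ?r"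
      using one unfolding fraction_rel_def by auto
    ultimately have "((z, \<one>), (\<zero>\<^bsub>Z\<^esub>, \<one>)) \<in> ?r" by blast
    then obtain u where u: "u \<in> ?S" "u \<odot>\<^bsub>Z\<^esub> (\<one> \<odot>\<^bsub>Z\<^esub> z) = u \<odot>\<^bsub>Z\<^esub> (\<one> \<odot>\<^bsub>Z\<^esub> \<zero>\<^bsub>Z\<^esub>)"
      unfolding fraction_rel_def by auto
    then show ?thesis using z by auto
  qed
  have "\<exists>t\<in>?S. \<forall>k<j. t \<odot>\<^bsub>Z\<^esub> g (unit_vec R d k) = \<zero>\<^bsub>Z\<^esub>" for j
  proof (induction j)
    case 0
    show ?case using one by blast
  next
    case (Suc j)
    then obtain t where t: "t \<in> ?S" "\<forall>k<j. t \<odot>\<^bsub>Z\<^esub> g (unit_vec R d k) = \<zero>\<^bsub>Z\<^esub>" by blast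
    have gZ: "g (unit_vec R d k) \<in> carrier Z" for k
      by (rule module_hom_closed[OF assms(2) Z.unit_vec_closed])
    obtain u where u: "u \<in> ?S" "u \<odot>\<^bsub>Z\<^esub> g (unit_vec R d j) = \<zero>\<^bsub>Z\<^esub>"
      using elt[OF gZ] by blast
    have "(u \<otimes> t) \<odot>\<^bsub>Z\<^esub> g (unit_vec R d k) = \<zero>\<^bsub>Z\<^esub>" if "k < Suc j" for k
    proof (cases "k = j")
      case True
      have "(u \<otimes> t) \<odot>\<^bsub>Z\<^esub> g (unit_vec R d j) = t \<odot>\<^bsub>Z\<^esub> (u \<odot>\<^bsub>Z\<^esub> g (unit_vec R d j))"
        using u t gZ Z.smult_assoc1[of t u "g (unit_vec R d j)"] Z.R.m_comm[of u t] by simp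
      then show ?thesis using True u t by simp
    next
      case False
      then show ?thesis using that u t gZ by (simp add: Z.smult_assoc1)
    qed
    then show ?case using mult[OF u(1) t(1)] by blast
  qed
  then obtain t where t: "t \<in> ?S" "\<forall>k<d. t \<odot>\<^bsub>Z\<^esub> g (unit_vec R d k) = \<zero>\<^bsub>Z\<^esub>" by blast
  have "t \<odot>\<^bsub>Z\<^esub> g v = \<zero>\<^bsub>Z\<^esub>" if "v \<in> carrier ?F" for v
    by (rule Z.hom_eq_on_basis[OF Z.module_axioms module_hom_scale[OF Z.module_axioms assms(2)]
          module_hom_const_zero[OF Z.module_axioms] _ that])
      (use t in auto)
  then show ?thesis using t(1) assms(3) by (intro bexI[of _ t]) auto
qed

section \<open>Syzygies\<close>

text \<open>\<open>syz_rank \<beta> (n + 1) = \<beta> n + \<beta> (n - 2) + \<dots>\<close>. The difference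
  \<open>syz_rank \<beta> (n + 1) - syz_rank \<beta> n\<close> is the alternating sum \<open>\<beta> n - \<beta> (n - 1) + \<dots>\<close>, the rank of
  the \<open>(n + 1)\<close>-st syzygy at the primes where \<open>M\<close> vanishes.\<close>

fun syz_rank :: "(nat \<Rightarrow> nat) \<Rightarrow> nat \<Rightarrow> nat" where
  "syz_rank \<beta> 0 = 0"
| "syz_rank \<beta> (Suc 0) = \<beta> 0"
| "syz_rank \<beta> (Suc (Suc n)) = \<beta> (Suc n) + syz_rank \<beta> n"

context
  fixes R :: "('a, 'c) ring_scheme" and M :: "('a, 'b, 'd) module_scheme"
    and \<beta> :: "nat \<Rightarrow> nat" and e :: "(nat \<Rightarrow> 'a) \<Rightarrow> 'b" and f :: "nat \<Rightarrow> (nat \<Rightarrow> 'a) \<Rightarrow> (nat \<Rightarrow> 'a)"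
  assumes M: "module R M"
    and res: "resolution R M (\<lambda>i. free_module R (\<beta> i)) e f"
begin

lemma res_free_module: "module R (free_module R (\<beta> i))"
  using res by (simp add: resolution_def)

lemma augmentation_hom: "e \<in> module_hom R (free_module R (\<beta> 0)) M"
  using res by (simp add: resolution_def)

lemma Syz_1: "Syz R M \<beta> e f (Suc 0) = (free_module R (\<beta> 0))\<lparr>carrier := module_ker (free_module R (\<beta> 0)) M e\<rparr>"
  by (simp add: Syz_def)

lemma Syz_simps:
  "\<zero>\<^bsub>Syz R M \<beta> e f (Suc n)\<^esub> = \<zero>\<^bsub>free_module R (\<beta> n)\<^esub>"
  "v \<oplus>\<^bsub>Syz R M \<beta> e f (Suc n)\<^esub> w = v \<oplus>\<^bsub>free_module R (\<beta> n)\<^esub> w"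
  "r \<odot>\<^bsub>Syz R M \<beta> e f (Suc n)\<^esub> v = r \<odot>\<^bsub>free_module R (\<beta> n)\<^esub> v"
  by (simp_all add: Syz_def Let_def)

text \<open>Describing a syzygy as the kernel of a map onto the preceding syzygy, rather than into a free module,
  lets the induction below proceed one short exact sequence at a time.\<close>

lemma Syz_Suc:
  "Syz R M \<beta> e f (Suc (Suc n)) =
     (free_module R (\<beta> (Suc n)))\<lparr>carrier :=
        module_ker (free_module R (\<beta> (Suc n))) (Syz R M \<beta> e f (Suc n)) (f (Suc n))\<rparr>"
  by (simp add: Syz_def Let_def module_ker_def)

lemma Syz_carrier: "carrier (Syz R M \<beta> e f (Suc n)) = f (Suc n) ` carrier (free_module R (\<beta> (Suc n)))"
  using res by (cases n) (simp_all add: Syz_def Let_def resolution_def)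

lemma Syz_carrier_subset: "carrier (Syz R M \<beta> e f (Suc n)) \<subseteq> carrier (free_module R (\<beta> n))"
  by (auto simp: Syz_def Let_def module_ker_def)

lemma differential_hom: "f (Suc n) \<in> module_hom R (free_module R (\<beta> (Suc n))) (Syz R M \<beta> e f (Suc n))"
proof -
  have "f (Suc n) \<in> module_hom R (free_module R (\<beta> (Suc n))) (free_module R (\<beta> n))"
    using res by (simp add: resolution_def)
  then show ?thesis
    by (intro module_homI)
      (simp_all add: Syz_carrier Syz_simps module_hom_add module_hom_smult del: free_module_simps)
qed

lemma Syz_module: "module R (Syz R M \<beta> e f (Suc n))"
proof (induction n)
  case 0
  show ?case unfolding Syz_1 by (rule module_ker_module[OF res_free_module M augmentation_hom])
next
  case (Suc n)
  show ?case unfolding Syz_Suc by (rule module_ker_module[OF res_free_module Suc differential_hom])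
qed

text \<open>The induction starts from \<open>M\<close>, which is zero up to \<open>y\<close> and for which the zero map is a section of \<open>e\<close> up to
  \<open>y\<close>. It carries along a section of the next differential. The exponent counts one factor \<open>y\<close>
  for \<open>M\<close> and one for each of the \<open>n + 1\<close> kernels taken.\<close>

lemma Syz_stably_free:
  assumes y: "y \<in> carrier R" and kill: "\<And>x. x \<in> carrier M \<Longrightarrow> y \<odot>\<^bsub>M\<^esub> x = \<zero>\<^bsub>M\<^esub>"
  shows "stably_free_up_to R (y [^]\<^bsub>R\<^esub> (n + 2)) (Syz R M \<beta> e f (Suc n)) (syz_rank \<beta> (Suc n)) (syz_rank \<beta> n)"
proof -
  interpret M: module R M by (rule M)
  have "stably_free_up_to R (y [^]\<^bsub>R\<^esub> (n + 2)) (Syz R M \<beta> e f (Suc n)) (syz_rank \<beta> (Suc n)) (syz_rank \<beta> n) \<and>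
    (\<exists>\<sigma> \<in> module_hom R (Syz R M \<beta> e f (Suc n)) (free_module R (\<beta> (Suc n))).
       \<forall>v\<in>carrier (Syz R M \<beta> e f (Suc n)). f (Suc n) (\<sigma> v) = y \<odot>\<^bsub>Syz R M \<beta> e f (Suc n)\<^esub> v)"
  proof (induction n)
    case 0
    have z: "(\<lambda>x. \<zero>\<^bsub>free_module R (\<beta> 0)\<^esub>) \<in> module_hom R M (free_module R (\<beta> 0))"
      by (rule module_hom_const_zero[OF res_free_module])
    have sec: "e \<zero>\<^bsub>free_module R (\<beta> 0)\<^esub> = y \<odot>\<^bsub>M\<^esub> x" if "x \<in> carrier M" for x
      using module_hom_zero[OF res_free_module M augmentation_hom] kill[OF that] by simp
    have "stably_free_up_to R (y \<otimes>\<^bsub>R\<^esub> y) (Syz R M \<beta> e f (Suc 0)) (\<beta> 0 + 0) 0"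
      unfolding Syz_1
      by (rule stably_free_up_to_kernel[OF M augmentation_hom z y y sec stably_free_up_to_zero[OF M y kill]])
    moreover obtain \<sigma> where "\<sigma> \<in> module_hom R (Syz R M \<beta> e f (Suc 0)) (free_module R (\<beta> (Suc 0)))"
      "\<And>v. v \<in> carrier (Syz R M \<beta> e f (Suc 0)) \<Longrightarrow> f (Suc 0) (\<sigma> v) = y \<odot>\<^bsub>Syz R M \<beta> e f (Suc 0)\<^esub> v"
      by (rule section_of_kernel[OF M augmentation_hom z y, folded Syz_1])
        (use sec differential_hom Syz_carrier[of 0] in \<open>auto simp del: free_module_simps\<close>)
    ultimately show ?case using y by (auto simp: numeral_2_eq_2)
  next
    case (Suc n)
    then obtain \<sigma> where sf: "stably_free_up_to R (y [^]\<^bsub>R\<^esub> (n + 2)) (Syz R M \<beta> e f (Suc n)) (syz_rank \<beta> (Suc n)) (syz_rank \<beta> n)"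
      and \<sigma>: "\<sigma> \<in> module_hom R (Syz R M \<beta> e f (Suc n)) (free_module R (\<beta> (Suc n)))"
      and sec: "\<And>v. v \<in> carrier (Syz R M \<beta> e f (Suc n)) \<Longrightarrow> f (Suc n) (\<sigma> v) = y \<odot>\<^bsub>Syz R M \<beta> e f (Suc n)\<^esub> v" by blast
    have "stably_free_up_to R (y [^]\<^bsub>R\<^esub> (n + 2) \<otimes>\<^bsub>R\<^esub> y) (Syz R M \<beta> e f (Suc (Suc n))) (\<beta> (Suc n) + syz_rank \<beta> n) (syz_rank \<beta> (Suc n))"
      unfolding Syz_Suc
      by (rule stably_free_up_to_kernel[OF Syz_module differential_hom \<sigma> y _ sec sf]) (use y in auto)
    moreover obtain \<tau> where "\<tau> \<in> module_hom R (Syz R M \<beta> e f (Suc (Suc n))) (free_module R (\<beta> (Suc (Suc n))))"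
      "\<And>v. v \<in> carrier (Syz R M \<beta> e f (Suc (Suc n))) \<Longrightarrow> f (Suc (Suc n)) (\<tau> v) = y \<odot>\<^bsub>Syz R M \<beta> e f (Suc (Suc n))\<^esub> v"
      by (rule section_of_kernel[OF Syz_module differential_hom \<sigma> y, folded Syz_Suc])
        (use sec differential_hom Syz_carrier[of "Suc n"] in \<open>auto simp del: free_module_simps\<close>)
    ultimately show ?case by auto
  qed
  then show ?thesis ..
qed

text \<open>If the next syzygy is zero, the resolution remains exact after its terms beyond degree \<open>n\<close> are replaced by
  free modules of rank \<open>0\<close>.\<close>

lemma proj_dim_le_of_Syz_zero:
  assumes zero: "carrier (Syz R M \<beta> e f (Suc n)) = {\<zero>\<^bsub>Syz R M \<beta> e f (Suc n)\<^esub>}"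
  shows "proj_dim R M \<le> enat n"
proof -
  interpret M: module R M by (rule M)
  define P where "P j = free_module R (if j \<le> n then \<beta> j else 0)" for j
  define g where "g j = (if j \<le> n then f j else (\<lambda>_. \<zero>\<^bsub>P (j - 1)\<^esub>))" for j
  have P_mod: "module R (P j)" for j unfolding P_def by (rule M.free_module_module)
  have P_small: "carrier (P j) = {\<zero>\<^bsub>P j\<^esub>}" if "n < j" for j
    using that by (auto simp: P_def intro!: ext)
  have P_F: "P j = free_module R (\<beta> j)" if "j \<le> n" for j using that by (simp add: P_def)
  have zero_image: "g (Suc j) ` carrier (P (Suc j)) = {\<zero>\<^bsub>P j\<^esub>}" if "n \<le> j" for j
    using that P_small[of "Suc j"] by (simp add: g_def)
  have g_f: "g j = f j" if "j \<le> n" for j using that by (simp add: g_def)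
  have SF: "carrier (Syz R M \<beta> e f (Suc n)) = {\<zero>\<^bsub>P n\<^esub>}" using zero P_F[of n] by (simp only: Syz_simps)
  have "resolution R M P e g"
    unfolding resolution_def
  proof (intro conjI allI)
    show "module R (P i)" for i by (rule P_mod)
    show "e \<in> module_hom R (P 0) M" "e ` carrier (P 0) = carrier M"
      using res P_F[of 0] by (simp_all add: resolution_def)
    show "g (Suc i) \<in> module_hom R (P (Suc i)) (P i)" for i
    proof (cases "Suc i \<le> n")
      case True
      then show ?thesis using res P_F[of i] P_F[of "Suc i"] by (simp add: g_def resolution_def)
    next
      case False
      then show ?thesis using module_hom_const_zero[OF P_mod] by (simp add: g_def)
    qed
    show "g 1 ` carrier (P 1) = module_ker (P 0) M e"
    proof (cases n)
      case 0
      then show ?thesis using zero_image[of 0] SF P_F[of 0] by (simp add: Syz_1)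
    next
      case (Suc k)
      then show ?thesis using res P_F[of 0] P_F[of 1] g_f[of 1] by (simp add: resolution_def)
    qed
    show "g (Suc (Suc i)) ` carrier (P (Suc (Suc i))) = module_ker (P (Suc i)) (P i) (g (Suc i))" for i
    proof -
      consider "Suc (Suc i) \<le> n" | "n = Suc i" | "n < Suc i" by linarith
      then show ?thesis
      proof cases
        case 1
        then show ?thesis
          using res P_F[of i] P_F[of "Suc i"] P_F[of "Suc (Suc i)"] g_f[of "Suc i"] g_f[of "Suc (Suc i)"]
          by (simp add: resolution_def)
      next
        case 2
        then show ?thesis
          using zero_image[of n] SF P_F[of i] P_F[of "Suc i"] g_f[of "Suc i"]
          by (simp add: Syz_Suc module_ker_def Syz_simps)
      next
        case 3
        then show ?thesis
          using zero_image[of "Suc i"] P_small[of "Suc i"] by (auto simp: module_ker_def g_def)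
      qed
    qed
  qed
  moreover have "\<forall>i. projective_module R (P i)"
    unfolding P_def using M.free_module_projective by blast
  moreover have "\<forall>i>n. carrier (P i) = {\<zero>\<^bsub>P i\<^esub>}" using P_small by blast
  ultimately show ?thesis
    unfolding proj_dim_def by (intro Inf_lower) blast
qed

end

section \<open>Support of the syzygies\<close>

theorem corollary3p2:
  fixes R :: "('a, 'c) ring_scheme"
    and M :: "('a, 'b, 'd) module_scheme"
    and \<beta> :: "nat \<Rightarrow> nat"
    and e :: "(nat \<Rightarrow> 'a) \<Rightarrow> 'b"
    and f :: "nat \<Rightarrow> (nat \<Rightarrow> 'a) \<Rightarrow> (nat \<Rightarrow> 'a)"
  assumes "noetherian_ring R" and "local_ring R"
    and "krull_dim R > 0"
    and "Ass R (regular_module R) = Assh R"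
    and "module R M" and "finitely_generated R M"
    and "module_length R M < \<infinity>"
    and "proj_dim R M = \<infinity>"
    and "minimal_free_resolution R M \<beta> e f"
  shows "\<forall>i>0. Supp R (Syz R M \<beta> e f i) = Spec R"
proof (intro allI impI)
  fix i :: nat assume "i > 0"
  then obtain n where i: "i = Suc n" by (cases i) auto
  interpret M: module R M by fact
  have res: "resolution R M (\<lambda>i. free_module R (\<beta> i)) e f"
    using assms(9) by (simp add: minimal_free_resolution_def)
  let ?Z = "Syz R M \<beta> e f (Suc n)"
  interpret Z: module R ?Z by (rule Syz_module[OF assms(5) res])
  obtain m where m: "maximalideal m R" and uniq: "\<And>m'. maximalideal m' R \<Longrightarrow> m' = m"
    using assms(2) unfolding local_ring_def by blast
  interpret m: maximalideal m R by (rule m)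
  have m_not_Ass: "m \<notin> Ass R (regular_module R)"
    using assms(3,4) krull_dim_quot_maximalideal[OF M.R.cring_axioms m] by (auto simp: Assh_def)
  have stable: "\<exists>N. stably_free_up_to R (y [^]\<^bsub>R\<^esub> (N::nat)) ?Z (syz_rank \<beta> (Suc n)) (syz_rank \<beta> n)"
    if y: "y \<in> m" for y
  proof -
    have yR: "y \<in> carrier R" using y m.a_subset by blast
    obtain N :: nat where N: "\<And>v. v \<in> carrier M \<Longrightarrow> (y [^]\<^bsub>R\<^esub> N) \<odot>\<^bsub>M\<^esub> v = \<zero>\<^bsub>M\<^esub>"
      using finite_length_power_kills[OF assms(1,2,5,7) m y] by blast
    have "stably_free_up_to R ((y [^]\<^bsub>R\<^esub> N) [^]\<^bsub>R\<^esub> (n + 2)) ?Z (syz_rank \<beta> (Suc n)) (syz_rank \<beta> n)"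
      by (rule Syz_stably_free[OF assms(5) res _ N]) (use yR in simp)
    then show ?thesis
      unfolding M.R.nat_pow_pow[OF yR] by blast
  qed
  show "Supp R (Syz R M \<beta> e f i) = Spec R"
  proof (rule ccontr)
    assume "Supp R (Syz R M \<beta> e f i) \<noteq> Spec R"
    then obtain p where p: "p \<in> Spec R" "p \<notin> Supp R ?Z"
      unfolding i by (auto simp: Supp_def)
    obtain t where t: "t \<in> carrier R" "t \<notin> p" and kill: "\<And>z. z \<in> carrier ?Z \<Longrightarrow> t \<odot>\<^bsub>?Z\<^esub> z = \<zero>\<^bsub>?Z\<^esub>"
      using not_in_Supp_annihilator[OF Z.module_axioms differential_hom[OF assms(5) res] Syz_carrier[OF assms(5) res] p]
      by blast
    have "z = \<zero>\<^bsub>?Z\<^esub>" if z: "z \<in> carrier ?Z" for z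
    proof (cases "t \<in> Units R")
      case True
      have "z = (inv\<^bsub>R\<^esub> t \<otimes>\<^bsub>R\<^esub> t) \<odot>\<^bsub>?Z\<^esub> z" using True z by simp
      also have "\<dots> = inv\<^bsub>R\<^esub> t \<odot>\<^bsub>?Z\<^esub> (t \<odot>\<^bsub>?Z\<^esub> z)"
        using True z t(1) by (intro Z.smult_assoc1) auto
      finally show ?thesis using kill[OF z] True by simp
    next
      case False
      then have "t \<in> m"
        using nonunit_in_maximalideal[OF M.R.cring_axioms assms(1) t(1)] uniq by metis
      then obtain N :: nat where N: "stably_free_up_to R (t [^]\<^bsub>R\<^esub> N) ?Z (syz_rank \<beta> (Suc n)) (syz_rank \<beta> n)"
        using stable by blast
      have nonnil: "(t \<otimes>\<^bsub>R\<^esub> t [^]\<^bsub>R\<^esub> N) [^]\<^bsub>R\<^esub> k \<noteq> \<zero>\<^bsub>R\<^esub>" for k :: nat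
      proof -
        interpret p: primeideal p R using p(1) by (simp add: Spec_def)
        have "(t \<otimes>\<^bsub>R\<^esub> t [^]\<^bsub>R\<^esub> N) [^]\<^bsub>R\<^esub> k = t [^]\<^bsub>R\<^esub> (Suc N * k)"
          using t(1) by (metis M.R.nat_pow_Suc2 M.R.nat_pow_pow)
        then show ?thesis
          using primeideal_pow[OF p.primeideal t] additive_subgroup.zero_closed[OF p.is_additive_subgroup] by metis
      qed
      have rank: "syz_rank \<beta> (Suc n) \<le> syz_rank \<beta> n"
        using stably_free_rank_le[OF assms(1) Z.module_axioms _ t(1) N kill nonnil] t(1) by simp
      show ?thesis
      proof (rule ccontr)
        assume nz: "z \<noteq> \<zero>\<^bsub>?Z\<^esub>"
        let ?F = "free_module R (\<beta> n)"
        have zF: "z \<in> carrier ?F" using z Syz_carrier_subset[OF assms(5) res] by blast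
        obtain j where j: "j < \<beta> n" "z j \<noteq> \<zero>\<^bsub>R\<^esub>"
          using nz zF vec_eqI[of z "\<beta> n" "carrier R" "\<zero>\<^bsub>?F\<^esub>" "carrier R"]
          unfolding Syz_simps[OF assms(5) res] by auto
        have "m \<in> Ass R (regular_module R)"
        proof (rule torsion_maximalideal_in_Ass[OF M.R.cring_axioms assms(1) m _ j(2)])
          show "z j \<in> carrier R" using zF j(1) by auto
          fix y assume y: "y \<in> m"
          then have yR: "y \<in> carrier R" using m.a_subset by blast
          from stable[OF y] obtain N :: nat
            where N: "stably_free_up_to R (y [^]\<^bsub>R\<^esub> N) ?Z (syz_rank \<beta> (Suc n)) (syz_rank \<beta> n)" by blast
          obtain k :: nat where "((y [^]\<^bsub>R\<^esub> N) [^]\<^bsub>R\<^esub> k) \<odot>\<^bsub>?Z\<^esub> z = \<zero>\<^bsub>?Z\<^esub>"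
            using stably_free_torsion[OF assms(1) Z.module_axioms _ N rank z] yR by auto
          then have "(y [^]\<^bsub>R\<^esub> (N * k)) \<odot>\<^bsub>?F\<^esub> z = \<zero>\<^bsub>?F\<^esub>"
            using yR by (simp add: M.R.nat_pow_pow Syz_simps[OF assms(5) res])
          from fun_cong[OF this, of j] show "\<exists>k::nat. y [^]\<^bsub>R\<^esub> k \<otimes>\<^bsub>R\<^esub> z j = \<zero>\<^bsub>R\<^esub>"
            using j(1) by auto
        qed
        with m_not_Ass show False ..
      qed
    qed
    then have "carrier ?Z = {\<zero>\<^bsub>?Z\<^esub>}" by auto
    from proj_dim_le_of_Syz_zero[OF assms(5) res this] show False
      using assms(8) by simp
  qed
qed

end
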